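(* Let $L,M,N$ be positive integers varying so that $M+N\to\infty$, and assume $\lim_{M+N\to\infty}M/N=\infty$ and $\lim_{M+N\to\infty}L/N=\tau\in(0,\infty)$. Given $k\in\{1,\ldots,N\}$, let $$\rho=2/\sqrt{N\big(\psi'(N-k+1)-\psi'(L+N-k+1)\big)},$$ and for $\theta\in(-\pi,\pi]$ set $$z_j=e^{M\left(\frac12\left(\psi(N-k+1)-\psi(L+N-k+1)\right)+\frac{v_j}{\rho\sqrt{MN}}\right)}\,e^{i(\theta+\phi_j)},\qquad j=1,\ldots,n.$$ Then the $n$-point correlation functions $R^{(n)}_{M,N}$ of the eigenvalues of $\Pi_M=X_M\cdots X_1$ (a product of i.i.d. truncated unitary matrices) satisfy $$\lim_{M+N\to\infty}\Big(\frac{\sqrt M}{\rho\sqrt N}\Big)^n|z_1\cdots z_n|^2R^{(n)}_{M,N}(z_1,\ldots,z_n)=\begin{cases}\dfrac{1}{(\sqrt{2\pi})^3}\,e^{-\frac12v_1^2},& n=1,\\[1ex]0,& n>1,\end{cases}$$ uniformly for $v_1,\ldots,v_n$ in a compact subset of $\mathbb R$ and $\phi_1,\ldots,\phi_n\in(-\pi,\pi]$.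
   Context: $\psi(z)=\Gamma'(z)/\Gamma(z)$ is the digamma function and $\psi'$ its derivative; $n\ge1$ is a fixed integer. $N$ may stay bounded or tend to infinity, and $k$ may vary with $M,N$. Model: $X_1,\ldots,X_M$ are i.i.d. truncated unitary matrices, each being the upper left $N\times N$ corner of a Haar-distributed random unitary $(N+L)\times(N+L)$ matrix, and $\Pi_M=X_M\cdots X_1$. The eigenvalues of $\Pi_M$ form a determinantal point process in $\mathbb C$ (with respect to Lebesgue measure), with correlation functions $R^{(n)}_{M,N}(z_1,\ldots,z_n)=\det[K_{M,N}(z_i,z_j)]_{i,j=1}^n$, where $$K_{M,N}(z_1,z_2)=\frac1\pi\sqrt{w(z_1)w(z_2)}\sum_{j=0}^{N-1}\frac{\Gamma^M(L+j+1)}{\Gamma^M(j+1)}(z_1\overline z_2)^j,\qquad w(z)=\int_{-c-i\infty}^{-c+i\infty}\frac{ds}{2\pi i}\,\frac{\Gamma^M(-s)}{\Gamma^M(L-s)}|z|^{2s}$$ for some $c>0$. *)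

theory Defs
  imports
    "HOL-Complex_Analysis.Complex_Analysis"
    "HOL-Probability.Probability"
    "Jordan_Normal_Form.Char_Poly"
    "Jordan_Normal_Form.Schur_Decomposition"
begin

text \<open>Matrices are those of Jordan_Normal_Form, with entries indexed from 0, because the
  dimensions vary along the limit.\<close>

definition mat_borel :: "nat \<Rightarrow> nat \<Rightarrow> complex mat measure" where
  "mat_borel r c = vimage_algebra (carrier_mat r c)
     (\<lambda>A. restrict (\<lambda>ij. A $$ ij) ({..<r} \<times> {..<c}))
     (PiM ({..<r} \<times> {..<c}) (\<lambda>_. borel))"

definition unitary_mats :: "nat \<Rightarrow> complex mat set" where
  "unitary_mats d = {U \<in> carrier_mat d d. mat_adjoint U * U = 1\<^sub>m d}"

text \<open>On the compact group of unitary matrices a left invariant probability measure is the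
  Haar measure.\<close>

definition haar_unitary :: "nat \<Rightarrow> complex mat measure \<Rightarrow> bool" where
  "haar_unitary d \<mu> \<longleftrightarrow> prob_space \<mu> \<and> sets \<mu> = sets (mat_borel d d) \<and>
     (AE U in \<mu>. U \<in> unitary_mats d) \<and>
     (\<forall>V \<in> unitary_mats d. distr \<mu> (mat_borel d d) (\<lambda>U. V * U) = \<mu>)"

definition upper_left :: "nat \<Rightarrow> complex mat \<Rightarrow> complex mat" where
  "upper_left N U = Matrix.mat N N (\<lambda>ij. U $$ ij)"

definition iid_truncated_unitary ::
    "'w measure \<Rightarrow> nat \<Rightarrow> nat \<Rightarrow> nat \<Rightarrow> (nat \<Rightarrow> 'w \<Rightarrow> complex mat) \<Rightarrow> bool" where
  "iid_truncated_unitary P N L M X \<longleftrightarrow> prob_space P \<and>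
     prob_space.indep_vars P (\<lambda>_. mat_borel N N) X {1..M} \<and>
     (\<exists>\<mu>. haar_unitary (N + L) \<mu> \<and>
        (\<forall>i \<in> {1..M}. distr P (mat_borel N N) (X i) = distr \<mu> (mat_borel N N) (upper_left N)))"

fun mat_product :: "nat \<Rightarrow> (nat \<Rightarrow> complex mat) \<Rightarrow> nat \<Rightarrow> complex mat" where
  "mat_product N X 0 = 1\<^sub>m N"
| "mat_product N X (Suc m) = X (Suc m) * mat_product N X m"

text \<open>The eigenvalues with algebraic multiplicity, in an arbitrary order; below they are only used
  in sums that do not depend on this order.\<close>

definition eigenvalue_list :: "complex mat \<Rightarrow> complex list" where
  "eigenvalue_list A = (SOME es. mset es = proots (char_poly A))"

text \<open>\<open>R\<close> is an \<open>n\<close>-point correlation function, with respect to Lebesgue measure on the complex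
  plane, of the random points listed by \<open>pts\<close>: it is the density of the \<open>n\<close>-th factorial moment
  measure. A configuration of \<open>n\<close> points \<open>z\<^sub>1, \<dots>, z\<^sub>n\<close> is a function on \<open>{1..n}\<close>.\<close>

definition correlation_function ::
    "'w measure \<Rightarrow> ('w \<Rightarrow> complex list) \<Rightarrow> nat \<Rightarrow> ((nat \<Rightarrow> complex) \<Rightarrow> real) \<Rightarrow> bool" where
  "correlation_function P pts n R \<longleftrightarrow>
     R \<in> borel_measurable (PiM {1..n} (\<lambda>_. lborel)) \<and>
     (\<forall>z \<in> {1..n} \<rightarrow>\<^sub>E UNIV. 0 \<le> R z) \<and>
     (\<forall>f :: (nat \<Rightarrow> complex) \<Rightarrow> ennreal. f \<in> borel_measurable (PiM {1..n} (\<lambda>_. lborel)) \<longrightarrow>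
        (\<integral>\<^sup>+ \<omega>. (\<Sum>\<sigma> \<in> {\<sigma> \<in> {1..n} \<rightarrow>\<^sub>E {..<length (pts \<omega>)}. inj_on \<sigma> {1..n}}.
                   f (\<lambda>j\<in>{1..n}. pts \<omega> ! \<sigma> j)) \<partial>P)
        = (\<integral>\<^sup>+ z. f z * ennreal (R z) \<partial>(PiM {1..n} (\<lambda>_. lborel))))"

text \<open>The integral over the vertical line is an improper contour integral: for \<open>M = L = 1\<close> it
  converges only conditionally. Its value is real and nonnegative, so that the principal
  square root in the kernel is the usual one.\<close>

definition weight :: "real \<Rightarrow> nat \<Rightarrow> nat \<Rightarrow> complex \<Rightarrow> complex" where
  "weight c L M z = Lim at_top (\<lambda>T::real.
     contour_integral (linepath (Complex (- c) (- T)) (Complex (- c) T))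
       (\<lambda>s. 1 / (2 * of_real pi * \<i>) *
            (Gamma (- s) ^ M / Gamma (of_nat L - s) ^ M) * of_real (cmod z) powr (2 * s)))"

definition truncated_kernel ::
    "real \<Rightarrow> nat \<Rightarrow> nat \<Rightarrow> nat \<Rightarrow> complex \<Rightarrow> complex \<Rightarrow> complex" where
  "truncated_kernel c L M N z1 z2 = 1 / of_real pi * csqrt (weight c L M z1 * weight c L M z2) *
     (\<Sum>j<N. Gamma (of_nat (L + j + 1)) ^ M / Gamma (of_nat (j + 1)) ^ M * (z1 * cnj z2) ^ j)"

definition kernel_det ::
    "(complex \<Rightarrow> complex \<Rightarrow> complex) \<Rightarrow> nat \<Rightarrow> (nat \<Rightarrow> complex) \<Rightarrow> complex" where
  "kernel_det K n z =
     Determinant.det (Matrix.mat n n (\<lambda>(i, j). K (z (Suc i)) (z (Suc j))))"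

definition rho :: "nat \<Rightarrow> nat \<Rightarrow> nat \<Rightarrow> real" where
  "rho L N k = 2 / sqrt (real N *
     (deriv Digamma (real N - real k + 1) - deriv Digamma (real L + real N - real k + 1)))"

definition scaled_point ::
    "nat \<Rightarrow> nat \<Rightarrow> nat \<Rightarrow> nat \<Rightarrow> real \<Rightarrow> real \<Rightarrow> real \<Rightarrow> complex" where
  "scaled_point L M N k \<theta> v \<phi> =
     of_real (exp (real M *
       (1 / 2 * (Digamma (real N - real k + 1) - Digamma (real L + real N - real k + 1))
        + v / (rho L N k * sqrt (real M * real N))))) *
     exp (\<i> * of_real (\<theta> + \<phi>))"

end

theory Submission
  imports Defs
begin

text \<open>Write \<open>b = N - k + 1\<close> and \<open>s\<^sup>2 = M \<Sum>m<L. 1/(b + m)\<^sup>2\<close>, so that \<open>s \<rightarrow> \<infinity>\<close> and the scaling prefactor is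
  \<open>s/2\<close>. Moving the contour of the weight to the line through \<open>b\<close> turns it into the Fourier inversion
  integral of a characteristic function, that of a standardized sum of \<open>M\<close> independent logarithms of
  beta variables. This function converges to \<open>exp (-\<xi>\<^sup>2/2)\<close> in \<open>L\<^sup>1\<close>, which yields a local central limit
  theorem, uniform in \<open>v\<close>, for the summand \<open>j = b - 1\<close> of the kernel. The other summands are
  exponentially smaller in \<open>s\<^sup>2\<close> because the means of the corresponding sums are separated by many
  standard deviations. Up to a diagonal conjugation by phases the rescaled kernel matrix therefore
  converges to a matrix of rank one, whose determinant vanishes for \<open>n > 1\<close>.\<close>

section \<open>The normalized characteristic function\<close>

text \<open>The index \<open>k\<close> varies freely with \<open>M\<close> and \<open>N\<close>, so
  \<open>b\<close> may stay at 1 or grow like \<open>N\<close>, and expansions of the Gamma function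
  for large argument are not at hand. The estimates therefore work with exact finite products over
  \<open>m < L\<close>, in which \<open>spread\<close> is the only large parameter. It is the
  standard deviation of a sum of \<open>M\<close> independent logarithms of Beta(\<open>b\<close>,
  \<open>L\<close>) variables: one such logarithm is minus a sum of independent exponential
  variables of rates \<open>b + m\<close>, with mean \<open>- (\<Sum>m<L. 1 / (b + m))\<close> and
  variance \<open>\<Sum>m<L. 1 / (b + m)\<^sup>2\<close>. These are the digamma and trigamma
  differences in the scaling of the points. Two obstacles shape the details. Fourier inversion needs
  an integrable characteristic function, which fails for \<open>L = M = 1\<close>; the analysis is
  done for \<open>M \<ge> 2\<close>, which \<open>M / N \<rightarrow> \<infinity>\<close> supplies
  in the end. The kernel contains the principal square root of a product of complex weights; instead
  of showing that the weights are real, the proof shows that, once rescaled, they are close to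
  positive numbers and that the square root is stable there.\<close>

definition spread :: "nat \<Rightarrow> nat \<Rightarrow> real \<Rightarrow> real" where
  "spread L M b = sqrt (real M * (\<Sum>m<L. 1 / (b + real m)\<^sup>2))"

text \<open>The moment of complex order \<open>t\<close> of a Beta(\<open>b\<close>,
  \<open>L\<close>) variable is \<open>pochhammer b L / pochhammer (b + t) L\<close>. At
  \<open>t = \<i> * \<xi> / spread L M b\<close> its factors are \<open>1 / (1 + \<i> * e)\<close>.
  The factors \<open>exp (\<i> * e)\<close> remove the mean of the logarithm, and the power
  \<open>M\<close> accounts for the independent copies.\<close>

definition normalized_cf :: "nat \<Rightarrow> nat \<Rightarrow> real \<Rightarrow> real \<Rightarrow> complex" where
  "normalized_cf L M b \<xi> = (\<Prod>m<L. let e = \<xi> / (spread L M b * (b + real m)) in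
     exp (\<i> * of_real e) / (1 + \<i> * of_real e)) ^ M"

lemma spread_power2: "(spread L M b)\<^sup>2 = real M * (\<Sum>m<L. 1 / (b + real m)\<^sup>2)"
  unfolding spread_def by (intro real_sqrt_pow2 mult_nonneg_nonneg sum_nonneg) auto

lemma spread_pos:
  assumes "L \<ge> 1" "M \<ge> 1" "b > 0"
  shows "spread L M b > 0"
proof -
  have "0 < (\<Sum>m<L. 1 / (b + real m)\<^sup>2)"
    using assms by (intro sum_pos) (auto simp: lessThan_empty_iff intro!: zero_less_power add_pos_nonneg)
  thus ?thesis using assms by (simp add: spread_def)
qed

text \<open>The standardized sum has variance one. This identity removes \<open>L\<close>,
  \<open>M\<close> and \<open>b\<close> from the later bounds, except through
  \<open>spread\<close>.\<close>

lemma sum_normalized_squares: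
  assumes "L \<ge> 1" "M \<ge> 1" "b > 0"
  shows "real M * (\<Sum>m<L. (\<xi> / (spread L M b * (b + real m)))\<^sup>2) = \<xi>\<^sup>2"
proof -
  have "real M * (\<Sum>m<L. (\<xi> / (spread L M b * (b + real m)))\<^sup>2)
      = \<xi>\<^sup>2 / (spread L M b)\<^sup>2 * (real M * (\<Sum>m<L. 1 / (b + real m)\<^sup>2))"
    by (simp add: sum_distrib_left power_divide power_mult_distrib mult_ac)
  also have "\<dots> = \<xi>\<^sup>2" using spread_pos[OF assms] by (simp flip: spread_power2)
  finally show ?thesis .
qed

section \<open>A uniform integrable majorant, and comparison with the Gaussian\<close>

lemma norm_one_plus_ii_power2: "(cmod (1 + \<i> * of_real e))\<^sup>2 = 1 + e\<^sup>2"
  by (simp add: cmod_power2)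

lemma norm_one_plus_ii_ge_1: "1 \<le> cmod (1 + \<i> * of_real e)"
  by (rule power2_le_imp_le) (simp_all add: norm_one_plus_ii_power2)

lemma prod_one_plus_ge: "(\<And>i. i \<in> A \<Longrightarrow> 0 \<le> f i) \<Longrightarrow> finite A \<Longrightarrow> 1 + (\<Sum>i\<in>A. f i) \<le> (\<Prod>i\<in>A. 1 + f i :: real)"
proof (induction A rule: infinite_finite_induct)
  case (insert x A)
  have "1 + (\<Sum>i\<in>insert x A. f i) \<le> (1 + f x) * (1 + (\<Sum>i\<in>A. f i))"
    using insert by (simp add: algebra_simps sum_nonneg)
  also have "\<dots> \<le> (1 + f x) * (\<Prod>i\<in>A. 1 + f i)"
    using insert by (intro mult_left_mono insert.IH) auto
  finally show ?case using insert by simp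
qed auto

text \<open>Bernoulli's inequality for the exponent \<open>M div 2\<close>, then squaring. The
  constant \<open>1 / 3\<close> is the least value of \<open>(M div 2) / M\<close> for
  \<open>M \<ge> 2\<close>, taken at \<open>M = 3\<close>.\<close>

lemma one_plus_div_power_ge:
  assumes "M \<ge> 2" "0 \<le> y"
  shows "(1 + y / 3)\<^sup>2 \<le> (1 + y / real M) ^ M"
proof -
  let ?k = "M div 2"
  have k: "1 / 3 \<le> real ?k / real M"
  proof -
    have "M \<le> 3 * ?k" using assms(1) by linarith
    hence "real M \<le> 3 * real ?k" by linarith
    thus ?thesis using assms(1) by (simp add: field_simps)
  qed
  have "1 + y / 3 \<le> 1 + real ?k * (y / real M)"
    using mult_right_mono[OF k assms(2)] by (simp add: field_simps)
  also have "\<dots> \<le> (1 + y / real M) ^ ?k"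
    using assms by (intro Bernoulli_inequality) (auto intro: order_trans[of _ 0])
  finally have "(1 + y / 3)\<^sup>2 \<le> ((1 + y / real M) ^ ?k)\<^sup>2"
    using assms by (intro power_mono) auto
  also have "\<dots> = (1 + y / real M) ^ (?k * 2)" by (simp add: power_mult)
  also have "\<dots> \<le> (1 + y / real M) ^ M"
    using assms by (intro power_increasing) auto
  finally show ?thesis .
qed

text \<open>The squared modulus of one factor is \<open>1 / (1 + e\<^sup>2)\<close>. Expanding the
  product over \<open>m\<close> to first order leaves \<open>(1 + \<xi>\<^sup>2 / M) ^ M\<close> in
  the denominator, which has at least quadratic growth in \<open>\<xi>\<^sup>2\<close> once
  \<open>M \<ge> 2\<close>. The resulting majorant is integrable and the same for all
  parameters.\<close>

lemma norm_normalized_cf_le: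
  assumes "L \<ge> 1" "M \<ge> 2" "b > 0"
  shows "cmod (normalized_cf L M b \<xi>) \<le> 1 / (1 + \<xi>\<^sup>2 / 3)"
proof -
  define e where "e = (\<lambda>m. \<xi> / (spread L M b * (b + real m)))"
  have sq: "real M * (\<Sum>m<L. (e m)\<^sup>2) = \<xi>\<^sup>2"
    unfolding e_def using assms by (intro sum_normalized_squares) auto
  have "(1 + \<xi>\<^sup>2 / 3)\<^sup>2 \<le> (1 + \<xi>\<^sup>2 / real M) ^ M"
    using assms by (intro one_plus_div_power_ge) auto
  also have "\<xi>\<^sup>2 / real M = (\<Sum>m<L. (e m)\<^sup>2)"
    using sq assms by (simp add: field_simps)
  also have "(1 + (\<Sum>m<L. (e m)\<^sup>2)) ^ M \<le> (\<Prod>m<L. 1 + (e m)\<^sup>2) ^ M"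
    by (intro power_mono prod_one_plus_ge add_nonneg_nonneg sum_nonneg) auto
  also have "\<dots> = ((\<Prod>m<L. cmod (1 + \<i> * of_real (e m))) ^ M)\<^sup>2"
  proof -
    have "(\<Prod>m<L. 1 + (e m)\<^sup>2) = (\<Prod>m<L. cmod (1 + \<i> * of_real (e m)))\<^sup>2"
      unfolding prod_power_distrib norm_one_plus_ii_power2 ..
    thus ?thesis by (simp only: mult.commute flip: power_mult)
  qed
  finally have "1 + \<xi>\<^sup>2 / 3 \<le> (\<Prod>m<L. cmod (1 + \<i> * of_real (e m))) ^ M"
    by (rule power2_le_imp_le) (auto intro!: prod_nonneg zero_le_power)
  moreover have "cmod (normalized_cf L M b \<xi>) = 1 / (\<Prod>m<L. cmod (1 + \<i> * of_real (e m))) ^ M"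
    by (simp add: normalized_cf_def Let_def norm_power norm_divide e_def prod_norm[symmetric] prod_dividef power_divide)
  moreover have "0 < 1 + \<xi>\<^sup>2 / 3" by (simp add: add_pos_nonneg)
  ultimately show ?thesis by (simp add: frac_le)
qed

text \<open>After multiplication by \<open>1 + \<i> * e\<close> the second-order Taylor polynomials
  of the two terms differ only by a multiple of \<open>e ^ 3\<close>. With the remainders
  \<open>r1\<close> and \<open>r2\<close> the constants add up to \<open>1/6 + 1/2 + 1/2\<close>,
  which is below 2.\<close>

lemma exp_ii_quotient_approx:
  assumes "\<bar>e\<bar> \<le> 1"
  shows "cmod (exp (\<i> * of_real e) / (1 + \<i> * of_real e) - of_real (exp (- (e\<^sup>2) / 2))) \<le> 2 * \<bar>e\<bar> ^ 3"
proof -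
  let ?u = "1 + \<i> * complex_of_real e"
  define r1 where "r1 = exp (\<i> * of_real e) - (\<Sum>k\<le>2. (\<i> * of_real e) ^ k / fact k)"
  define r2 where "r2 = exp (- (e\<^sup>2) / 2) - (1 - e\<^sup>2 / 2)"
  have r1: "cmod r1 \<le> \<bar>e\<bar> ^ 3 / 6"
    using iexp_approx1[of e 2] by (simp add: r1_def eval_nat_numeral)
  have r2: "\<bar>r2\<bar> \<le> \<bar>e\<bar> ^ 4 / 4"
  proof -
    have 1: "0 \<le> r2" using exp_ge_add_one_self[of "- (e\<^sup>2) / 2"] by (simp add: r2_def)
    have "exp (- (e\<^sup>2 / 2)) \<le> 1 / (1 + e\<^sup>2 / 2)"
      using exp_ge_add_one_self[of "e\<^sup>2 / 2"]
      by (simp add: exp_minus inverse_eq_divide frac_le add_pos_nonneg)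
    \<comment> \<open>With \<open>x = e\<^sup>2 / 2\<close> the claim is
      \<open>1 \<le> (1 - x + x\<^sup>2) * (1 + x)\<close>, and the right side equals
      \<open>1 + x ^ 3\<close>.\<close>
    also have "\<dots> \<le> 1 - e\<^sup>2 / 2 + \<bar>e\<bar> ^ 4 / 4"
    proof -
      have "(1 - e\<^sup>2 / 2 + e ^ 4 / 4) * (1 + e\<^sup>2 / 2) = 1 + e ^ 6 / 8"
        by (simp add: algebra_simps power2_eq_square eval_nat_numeral)
      hence "1 \<le> (1 - e\<^sup>2 / 2 + e ^ 4 / 4) * (1 + e\<^sup>2 / 2)" by simp
      thus ?thesis by (subst pos_divide_le_eq) (auto simp: add_pos_nonneg)
    qed
    finally show ?thesis using 1 by (simp add: r2_def)
  qed
  have eq: "exp (\<i> * of_real e) / ?u - of_real (exp (- (e\<^sup>2) / 2))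
      = (r1 + \<i> * of_real (e ^ 3 / 2) - ?u * of_real r2) / ?u"
  proof -
    have u: "?u \<noteq> 0" using norm_one_plus_ii_ge_1[of e] by auto
    have x1: "exp (\<i> * of_real e) = r1 + 1 + \<i> * of_real e - (of_real e)\<^sup>2 / 2"
      by (simp add: r1_def eval_nat_numeral algebra_simps)
    have x2: "complex_of_real (exp (- (e\<^sup>2) / 2)) = of_real r2 + 1 - (of_real e)\<^sup>2 / 2"
      by (simp add: r2_def)
    have "(r1 + 1 + \<i> * of_real e - (of_real e)\<^sup>2 / 2) - (of_real r2 + 1 - (of_real e)\<^sup>2 / 2) * ?u
        = r1 + \<i> * of_real (e ^ 3 / 2) - ?u * of_real r2"
      by (simp add: field_simps power2_eq_square power3_eq_cube)
    moreover have "x / ?u - y = (x - y * ?u) / ?u" for x y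
      using u by (simp add: diff_divide_distrib)
    ultimately show ?thesis unfolding x1 x2 by presburger
  qed
  have "cmod (exp (\<i> * of_real e) / ?u - of_real (exp (- (e\<^sup>2) / 2)))
     \<le> cmod (r1 + \<i> * of_real (e ^ 3 / 2) - ?u * of_real r2)"
    unfolding eq norm_divide using norm_one_plus_ii_ge_1[of e]
    by (simp add: divide_le_eq mult_le_cancel_left1 mult_le_cancel_left2)
  also have "\<dots> \<le> cmod r1 + \<bar>e\<bar> ^ 3 / 2 + cmod ?u * \<bar>r2\<bar>"
    by (rule order_trans[OF norm_triangle_ineq4] add_mono order_trans[OF norm_triangle_ineq])+
       (auto simp: norm_mult norm_divide norm_power)
  also have "\<dots> \<le> \<bar>e\<bar> ^ 3 / 6 + \<bar>e\<bar> ^ 3 / 2 + 2 * (\<bar>e\<bar> ^ 4 / 4)"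
  proof -
    have "cmod ?u \<le> 2" using assms norm_triangle_ineq[of 1 "\<i> * complex_of_real e"] by (simp add: norm_mult)
    thus ?thesis using r1 r2 by (intro add_mono mult_mono) auto
  qed
  also have "\<dots> \<le> 2 * \<bar>e\<bar> ^ 3"
    using power_decreasing[of 3 4 "\<bar>e\<bar>"] zero_le_power[OF abs_ge_zero, of e 3] assms by linarith
  finally show ?thesis .
qed

text \<open>Lyapunov's argument. All factors have modulus at most one, so the difference of the
  products is at most the sum of the differences of the factors, each cubic in \<open>e m\<close>.
  Since \<open>b \<ge> 1\<close> gives \<open>\<bar>e m\<bar> \<le> \<bar>\<xi>\<bar> / s\<close>,
  one power is split off and the remaining squares have total \<open>\<xi>\<^sup>2\<close>.\<close>

lemma normalized_cf_approx:
  assumes "L \<ge> 1" "M \<ge> 1" "b \<ge> 1" and le: "\<bar>\<xi>\<bar> \<le> spread L M b"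
  shows "cmod (normalized_cf L M b \<xi> - of_real (exp (- (\<xi>\<^sup>2) / 2))) \<le> 2 * \<bar>\<xi>\<bar> ^ 3 / spread L M b"
proof -
  define s where "s = spread L M b"
  have s: "s > 0" using spread_pos assms by (auto simp: s_def)
  define e where "e = (\<lambda>m. \<xi> / (s * (b + real m)))"
  define x where "x = (\<lambda>m. exp (\<i> * of_real (e m)) / (1 + \<i> * of_real (e m)))"
  define y where "y = (\<lambda>m. complex_of_real (exp (- ((e m)\<^sup>2) / 2)))"
  have sq: "real M * (\<Sum>m<L. (e m)\<^sup>2) = \<xi>\<^sup>2"
    unfolding e_def s_def using assms by (intro sum_normalized_squares) auto
  have e: "\<bar>e m\<bar> \<le> \<bar>\<xi>\<bar> / s" for m
  proof -
    have "s * 1 \<le> s * (b + real m)" using s assms by (intro mult_left_mono) auto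
    thus ?thesis using s assms
      unfolding e_def abs_divide by (intro divide_left_mono) (auto simp: abs_mult)
  qed
  have e1: "\<bar>e m\<bar> \<le> 1" for m
  proof -
    have "\<bar>\<xi>\<bar> / s \<le> 1" using le s by (simp add: s_def)
    thus ?thesis using e[of m] by linarith
  qed
  have nx: "cmod (x m) \<le> 1" for m
    using norm_one_plus_ii_ge_1[of "e m"] by (simp add: x_def norm_divide divide_le_eq)
  have ny: "cmod (y m) \<le> 1" for m
    unfolding y_def norm_of_real by simp
  have "normalized_cf L M b \<xi> = (\<Prod>m<L. x m) ^ M"
    by (simp add: normalized_cf_def x_def e_def s_def Let_def)
  moreover have "complex_of_real (exp (- (\<xi>\<^sup>2) / 2)) = (\<Prod>m<L. y m) ^ M"
  proof -
    have "(\<Prod>m<L. y m) ^ M = of_real ((\<Prod>m<L. exp (- ((e m)\<^sup>2) / 2)) ^ M)" by (simp add: y_def)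
    also have "(\<Prod>m<L. exp (- ((e m)\<^sup>2) / 2)) ^ M = exp (real M * (\<Sum>m<L. - ((e m)\<^sup>2) / 2))"
      by (simp add: exp_sum exp_of_nat_mult)
    also have "real M * (\<Sum>m<L. - ((e m)\<^sup>2) / 2) = - (\<xi>\<^sup>2) / 2"
      using sq by (simp add: sum_negf sum_divide_distrib[symmetric])
    finally show ?thesis by simp
  qed
  ultimately have "cmod (normalized_cf L M b \<xi> - of_real (exp (- (\<xi>\<^sup>2) / 2)))
      = cmod ((\<Prod>m<L. x m) ^ M - (\<Prod>m<L. y m) ^ M)" by simp
  also have "\<dots> \<le> real M * cmod ((\<Prod>m<L. x m) - (\<Prod>m<L. y m))"
    by (intro norm_power_diff) (auto simp: prod_norm[symmetric] intro!: prod_le_1 nx ny)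
  also have "\<dots> \<le> real M * (\<Sum>m<L. cmod (x m - y m))"
    by (intro mult_left_mono norm_prod_diff nx ny) auto
  also have "\<dots> \<le> real M * (\<Sum>m<L. 2 * \<bar>e m\<bar> ^ 3)"
    unfolding x_def y_def by (intro mult_left_mono sum_mono exp_ii_quotient_approx e1) auto
  also have "\<dots> \<le> real M * (\<Sum>m<L. 2 * (\<bar>\<xi>\<bar> / s) * (e m)\<^sup>2)"
  proof (intro mult_left_mono sum_mono)
    fix m
    have "\<bar>e m\<bar> ^ 3 = \<bar>e m\<bar> * (e m)\<^sup>2" by (simp add: power3_eq_cube power2_eq_square)
    also have "\<dots> \<le> (\<bar>\<xi>\<bar> / s) * (e m)\<^sup>2" by (intro mult_right_mono e) auto
    finally show "2 * \<bar>e m\<bar> ^ 3 \<le> 2 * (\<bar>\<xi>\<bar> / s) * (e m)\<^sup>2" by simp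
  qed auto
  also have "\<dots> = 2 * (\<bar>\<xi>\<bar> / s) * (real M * (\<Sum>m<L. (e m)\<^sup>2))"
    by (simp add: sum_distrib_left mult_ac)
  also have "\<dots> = 2 * \<bar>\<xi>\<bar> ^ 3 / s"
    unfolding sq by (simp add: power3_eq_cube power2_eq_square)
  finally show ?thesis by (simp add: s_def)
qed

lemma borel_measurable_normalized_cf [measurable]: "normalized_cf L M b \<in> borel_measurable borel"
  unfolding normalized_cf_def[abs_def] Let_def by measurable

lemma integrable_inverse_one_plus_square: "integrable lborel (\<lambda>x::real. 1 / (1 + x\<^sup>2 / 3))"
proof (rule Bochner_Integration.integrable_bound)
  have "integrable lborel (\<lambda>x::real. inverse (1 + x\<^sup>2))"
    using integrable_inverse_1_plus_square by (simp add: set_integrable_def einterval_def)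
  thus "integrable lborel (\<lambda>x::real. 3 * inverse (1 + x\<^sup>2))" by simp
  show "AE x in lborel. norm (1 / (1 + x\<^sup>2 / 3)) \<le> norm (3 * inverse (1 + x\<^sup>2 :: real))"
  proof (intro AE_I2)
    fix x :: real
    have "0 < 1 + x\<^sup>2" "0 < 3 + x\<^sup>2" by (simp_all add: add_pos_nonneg)
    thus "norm (1 / (1 + x\<^sup>2 / 3)) \<le> norm (3 * inverse (1 + x\<^sup>2))"
      by (simp add: field_simps)
  qed
qed auto

lemma integrable_normalized_cf:
  assumes "L \<ge> 1" "M \<ge> 2" "b > 0"
  shows "integrable lborel (normalized_cf L M b)"
  by (rule Bochner_Integration.integrable_bound[OF integrable_inverse_one_plus_square])
     (auto intro!: AE_I2 order_trans[OF norm_normalized_cf_le[OF assms]])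

lemma normalized_cf_L1_limit:
  fixes L M :: "nat \<Rightarrow> nat" and b :: "nat \<Rightarrow> real"
  assumes "\<And>l. L l \<ge> 1" "\<And>l. M l \<ge> 2" "\<And>l. b l \<ge> 1"
    and lim: "filterlim (\<lambda>l. spread (L l) (M l) (b l)) at_top sequentially"
  shows "(\<lambda>l. \<integral>\<xi>. cmod (normalized_cf (L l) (M l) (b l) \<xi> - of_real (exp (- (\<xi>\<^sup>2) / 2))) \<partial>lborel) \<longlonglongrightarrow> 0"
proof -
  \<comment> \<open>The Gaussian obeys the same majorant as the characteristic functions, hence the
    factor 2 in the dominating function below.\<close>
  have gauss: "exp (- (\<xi>\<^sup>2) / 2) \<le> 1 / (1 + \<xi>\<^sup>2 / 3)" for \<xi> :: real
  proof -
    have "1 + \<xi>\<^sup>2 / 3 \<le> exp (\<xi>\<^sup>2 / 2)" using exp_ge_add_one_self[of "\<xi>\<^sup>2 / 2"] zero_le_power2[of \<xi>]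
      by linarith
    moreover have "0 < 1 + \<xi>\<^sup>2 / 3" by (simp add: add_pos_nonneg)
    ultimately have "1 / exp (\<xi>\<^sup>2 / 2) \<le> 1 / (1 + \<xi>\<^sup>2 / 3)" by (intro divide_left_mono) auto
    thus ?thesis by (simp add: exp_minus inverse_eq_divide)
  qed
  have "(\<lambda>l. \<integral>\<xi>. cmod (normalized_cf (L l) (M l) (b l) \<xi> - of_real (exp (- (\<xi>\<^sup>2) / 2))) \<partial>lborel)
     \<longlonglongrightarrow> (\<integral>\<xi>. 0 \<partial>(lborel :: real measure))"

  proof (rule integral_dominated_convergence[where w = "\<lambda>\<xi>. 2 * (1 / (1 + \<xi>\<^sup>2 / 3))"])
    show "integrable lborel (\<lambda>\<xi>::real. 2 * (1 / (1 + \<xi>\<^sup>2 / 3)))"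
      by (intro integrable_mult_right integrable_inverse_one_plus_square)
    show "AE \<xi> in lborel. norm (cmod (normalized_cf (L l) (M l) (b l) \<xi> - of_real (exp (- (\<xi>\<^sup>2) / 2))))
        \<le> 2 * (1 / (1 + \<xi>\<^sup>2 / 3))" for l
    proof (intro AE_I2)
      fix \<xi> :: real
      have "cmod (normalized_cf (L l) (M l) (b l) \<xi> - of_real (exp (- (\<xi>\<^sup>2) / 2)))
         \<le> cmod (normalized_cf (L l) (M l) (b l) \<xi>) + exp (- (\<xi>\<^sup>2) / 2)"
        by (rule order_trans[OF norm_triangle_ineq4]) (simp del: of_real_exp)
      moreover have "cmod (normalized_cf (L l) (M l) (b l) \<xi>) \<le> 1 / (1 + \<xi>\<^sup>2 / 3)"
        using assms(1)[of l] assms(2)[of l] assms(3)[of l] by (intro norm_normalized_cf_le) auto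
      ultimately show "norm (cmod (normalized_cf (L l) (M l) (b l) \<xi> - of_real (exp (- (\<xi>\<^sup>2) / 2))))
        \<le> 2 * (1 / (1 + \<xi>\<^sup>2 / 3))" using gauss[of \<xi>] by simp
    qed
    show "AE \<xi> in lborel. (\<lambda>l. cmod (normalized_cf (L l) (M l) (b l) \<xi> - of_real (exp (- (\<xi>\<^sup>2) / 2)))) \<longlonglongrightarrow> 0"
    proof (intro AE_I2)
      fix \<xi> :: real
      have "(\<lambda>l. 2 * \<bar>\<xi>\<bar> ^ 3 / spread (L l) (M l) (b l)) \<longlonglongrightarrow> 0"
        by (rule real_tendsto_divide_at_top[OF tendsto_const lim])
      moreover have "eventually (\<lambda>l. \<bar>\<xi>\<bar> \<le> spread (L l) (M l) (b l)) sequentially"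
        using lim by (simp add: filterlim_at_top)
      hence "eventually (\<lambda>l. norm (normalized_cf (L l) (M l) (b l) \<xi> - of_real (exp (- (\<xi>\<^sup>2) / 2)))
         \<le> 2 * \<bar>\<xi>\<bar> ^ 3 / spread (L l) (M l) (b l)) sequentially"
        by eventually_elim (intro normalized_cf_approx, use assms(1-3) order_trans[OF _ assms(2), of 1] in auto)
      ultimately show "(\<lambda>l. cmod (normalized_cf (L l) (M l) (b l) \<xi> - of_real (exp (- (\<xi>\<^sup>2) / 2)))) \<longlonglongrightarrow> 0"
        by (intro tendsto_norm_zero) (rule Lim_null_comparison)
    qed
  qed auto
  thus ?thesis by simp
qed

lemma gaussian_fourier_integral:
  "(\<integral>\<xi>. of_real (exp (- (\<xi>\<^sup>2) / 2)) * exp (- \<i> * of_real (\<xi> * v)) \<partial>lborel)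
     = complex_of_real (sqrt (2 * pi) * exp (- (v\<^sup>2) / 2))"
proof -
  have "complex_of_real (exp (- (v\<^sup>2) / 2)) = char std_normal_distribution (- v)"
    by (simp add: char_std_normal_distribution)
  also have "\<dots> = (\<integral>\<xi>. std_normal_density \<xi> *\<^sub>R exp (\<i> * of_real (- v * \<xi>)) \<partial>lborel)"
    unfolding char_def by (subst integral_density) (auto simp: normal_density_nonneg)
  also have "\<dots> = (\<integral>\<xi>. complex_of_real (1 / sqrt (2 * pi)) *
      (of_real (exp (- (\<xi>\<^sup>2) / 2)) * exp (- \<i> * of_real (\<xi> * v))) \<partial>lborel)"
    by (intro Bochner_Integration.integral_cong refl)
       (simp add: std_normal_density_def scaleR_conv_of_real mult_ac)
  also have "\<dots> = complex_of_real (1 / sqrt (2 * pi)) *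
      (\<integral>\<xi>. of_real (exp (- (\<xi>\<^sup>2) / 2)) * exp (- \<i> * of_real (\<xi> * v)) \<partial>lborel)"
    by (rule integral_mult_right_zero)
  finally have "(\<integral>\<xi>. of_real (exp (- (\<xi>\<^sup>2) / 2)) * exp (- \<i> * of_real (\<xi> * v)) \<partial>lborel)
     = complex_of_real (sqrt (2 * pi)) * complex_of_real (exp (- (v\<^sup>2) / 2))"
    by (simp only:) simp
  thus ?thesis by (simp only: of_real_mult)
qed

section \<open>Shifting the contour of the weight\<close>

text \<open>With a primitive on the half-plane, the difference of the truncated integrals becomes
  that of the two horizontal sides at heights \<open>T\<close> and \<open>- T\<close>, which are of
  order \<open>1 / T\<^sup>2\<close>. Convergence along the second line is a conclusion: the lemma
  is applied from the line on which the integrand has been identified explicitly to the line that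
  defines the weight.\<close>

lemma vertical_line_shift:
  fixes a b C :: real
  assumes holo: "f holomorphic_on {s. Re s < 0}" and neg: "a < 0" "b < 0"
    and bound: "\<And>s. Re s \<in> closed_segment a b \<Longrightarrow> 1 \<le> \<bar>Im s\<bar> \<Longrightarrow> cmod (f s) \<le> C / (Im s)\<^sup>2"
    and lim: "((\<lambda>T. contour_integral (linepath (Complex a (- T)) (Complex a T)) f) \<longlongrightarrow> I) at_top"
  shows "((\<lambda>T. contour_integral (linepath (Complex b (- T)) (Complex b T)) f) \<longlongrightarrow> I) at_top"
proof -
  let ?S = "{s. Re s < 0}"
  have conv: "convex ?S" by (rule convex_halfspace_Re_lt)
  obtain F where F: "\<And>s. s \<in> ?S \<Longrightarrow> (F has_field_derivative f s) (at s within ?S)"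
    using holomorphic_convex_primitive'[OF conv open_halfspace_Re_lt holo] by blast
  have ci: "(f has_contour_integral F q - F p) (linepath p q)" if "Re p < 0" "Re q < 0" for p q
    using contour_integral_primitive[OF F valid_path_linepath, of p q]
      closed_segment_subset[OF _ _ conv, of p q] that by simp
  have bd: "cmod (F (Complex b t) - F (Complex a t)) \<le> C / t\<^sup>2 * \<bar>b - a\<bar>" if "1 \<le> \<bar>t\<bar>" for t
  proof -
    have "cmod (F (Complex b t) - F (Complex a t)) \<le> C / t\<^sup>2 * cmod (Complex b t - Complex a t)"
    proof (rule has_contour_integral_bound_linepath)
      show "(f has_contour_integral F (Complex b t) - F (Complex a t)) (linepath (Complex a t) (Complex b t))"
        by (intro ci) (use neg in auto)
      show "0 \<le> C / t\<^sup>2"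
        using order_trans[OF norm_ge_zero bound[of "Complex a t"]] that by simp
      show "cmod (f x) \<le> C / t\<^sup>2" if x: "x \<in> closed_segment (Complex a t) (Complex b t)" for x
      proof -
        have "Im x = t" "Re x \<in> closed_segment a b"
          using x by (auto simp: closed_segment_def complex_eq_iff algebra_simps)
        thus ?thesis using bound[of x] \<open>1 \<le> \<bar>t\<bar>\<close> by simp
      qed
    qed
    also have "Complex b t - Complex a t = of_real (b - a)" by (simp add: complex_eq_iff)
    finally show ?thesis by (simp only: norm_of_real)
  qed
  have "((\<lambda>T. contour_integral (linepath (Complex b (- T)) (Complex b T)) f
            - contour_integral (linepath (Complex a (- T)) (Complex a T)) f) \<longlongrightarrow> 0) at_top"
  proof (rule Lim_null_comparison)
    show "eventually (\<lambda>T. cmod (contour_integral (linepath (Complex b (- T)) (Complex b T)) f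
            - contour_integral (linepath (Complex a (- T)) (Complex a T)) f)
          \<le> 2 * C * \<bar>b - a\<bar> * inverse (T\<^sup>2)) at_top"
      using eventually_ge_at_top[of "1::real"]
    proof eventually_elim
      case (elim T)
      have "contour_integral (linepath (Complex x (- T)) (Complex x T)) f = F (Complex x T) - F (Complex x (- T))"
        if "x < 0" for x
        using that by (intro contour_integral_unique ci) auto
      hence "contour_integral (linepath (Complex b (- T)) (Complex b T)) f
            - contour_integral (linepath (Complex a (- T)) (Complex a T)) f
          = (F (Complex b T) - F (Complex a T)) - (F (Complex b (- T)) - F (Complex a (- T)))"
        using neg by (simp add: algebra_simps)
      also have "cmod \<dots> \<le> C / T\<^sup>2 * \<bar>b - a\<bar> + C / T\<^sup>2 * \<bar>b - a\<bar>"
        using bd[of T] bd[of "- T"] elim by (intro order_trans[OF norm_triangle_ineq4[of "F (Complex b T) - F (Complex a T)"]] add_mono) auto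
      finally show ?case by (simp add: field_simps)
    qed
    have "((\<lambda>T::real. inverse (T\<^sup>2)) \<longlongrightarrow> 0) at_top"
      by (intro tendsto_inverse_0_at_top filterlim_pow_at_top filterlim_ident) auto
    thus "((\<lambda>T::real. 2 * C * \<bar>b - a\<bar> * inverse (T\<^sup>2)) \<longlongrightarrow> 0) at_top"
      by (rule tendsto_mult_right_zero)
  qed
  from tendsto_add[OF this lim] show ?thesis by simp
qed

text \<open>Dominated convergence for the truncations; the factor \<open>\<i>\<close> is the
  derivative of the parametrization of the line by its height.\<close>

lemma tendsto_vertical_contour_integral:
  fixes f :: "complex \<Rightarrow> complex" and a :: real
  assumes int: "integrable lborel (\<lambda>t. f (Complex a t))"
  shows "((\<lambda>T. contour_integral (linepath (Complex a (- T)) (Complex a T)) f)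
    \<longlongrightarrow> \<i> * (\<integral>t. f (Complex a t) \<partial>lborel)) at_top"
proof -
  let ?h = "\<lambda>t. f (Complex a t)"
  have "((\<lambda>T. \<integral>t. indicator {-T..T} t *\<^sub>R ?h t \<partial>lborel) \<longlongrightarrow> (\<integral>t. ?h t \<partial>lborel)) at_top"
  proof (rule integral_dominated_convergence_at_top[where w = "\<lambda>t. cmod (?h t)"])
    show "AE t in lborel. ((\<lambda>T. indicator {-T..T} t *\<^sub>R ?h t) \<longlongrightarrow> ?h t) at_top"
    proof (intro AE_I2 tendsto_eventually)
      fix t :: real
      show "eventually (\<lambda>T. indicator {-T..T} t *\<^sub>R ?h t = ?h t) at_top"
        using eventually_ge_at_top[of "\<bar>t\<bar>"] by eventually_elim (auto simp: indicator_def)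
    qed
  qed (use int in \<open>auto simp: indicator_def\<close>)
  hence "((\<lambda>T. \<i> * (\<integral>t. indicator {-T..T} t *\<^sub>R ?h t \<partial>lborel)) \<longlongrightarrow> \<i> * (\<integral>t. ?h t \<partial>lborel)) at_top"
    by (intro tendsto_intros)
  moreover have "eventually (\<lambda>T. \<i> * (\<integral>t. indicator {-T..T} t *\<^sub>R ?h t \<partial>lborel)
      = contour_integral (linepath (Complex a (- T)) (Complex a T)) f) at_top"
    using eventually_gt_at_top[of "0::real"]
  proof eventually_elim
    case (elim T)
    have "set_integrable lborel {-T..T} ?h"
      unfolding set_integrable_def using int by (intro integrable_mult_indicator) auto
    hence "(\<integral>t. indicator {-T..T} t *\<^sub>R ?h t \<partial>lborel) = integral {-T..T} ?h"
      using set_borel_integral_eq_integral(2)[of "{-T..T}" ?h] by (simp add: set_lebesgue_integral_def)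
    thus ?case using elim by (subst contour_integral_linepath_same_Re[of _ a _ "- T" T]) auto
  qed
  ultimately show ?thesis by (rule Lim_transform_eventually)
qed

text \<open>The integrand of the weight at \<open>s = - u\<close>, without the constant:
  \<open>Gamma u / Gamma (L + u)\<close> is \<open>1 / pochhammer u L\<close>, and \<open>y\<close>
  stands for \<open>2 * ln (cmod z)\<close>. In this form it is plain that there are no poles in the
  right half-plane.\<close>

definition mellin_integrand :: "nat \<Rightarrow> nat \<Rightarrow> real \<Rightarrow> complex \<Rightarrow> complex" where
  "mellin_integrand L M y u = exp (- (of_real y * u)) / pochhammer u L ^ M"

lemma norm_pochhammer_ge: "0 < Re u \<Longrightarrow> cmod u ^ L \<le> cmod (pochhammer u L)"
proof -
  assume u: "0 < Re u"
  have "cmod u \<le> cmod (u + of_nat m)" for m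
  proof (rule power2_le_imp_le)
    have "(Re u)\<^sup>2 \<le> (Re u + real m)\<^sup>2" using u by (intro power_mono) auto
    thus "(cmod u)\<^sup>2 \<le> (cmod (u + of_nat m))\<^sup>2" by (simp add: cmod_power2)
  qed auto
  hence "(\<Prod>m<L. cmod u) \<le> (\<Prod>m<L. cmod (u + of_nat m))" by (intro prod_mono) auto
  thus ?thesis by (simp add: pochhammer_prod prod_norm atLeast0LessThan)
qed

lemma pochhammer_nonzero:
  assumes "0 < Re u" shows "pochhammer u L \<noteq> 0"
proof -
  have "u \<noteq> 0" using assms by auto
  hence "0 < cmod u ^ L" by simp
  also have "\<dots> \<le> cmod (pochhammer u L)" using assms by (rule norm_pochhammer_ge)
  finally show ?thesis by simp
qed

lemma holomorphic_mellin_integrand: "(\<lambda>s. mellin_integrand L M y (- s)) holomorphic_on {s. Re s < 0}"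
  unfolding mellin_integrand_def pochhammer_prod
  by (intro holomorphic_intros) (auto simp: pochhammer_nonzero simp flip: pochhammer_prod)

text \<open>The denominator has degree \<open>L * M \<ge> 2\<close> in \<open>u\<close>, and
  \<open>1 \<le> \<bar>Im u\<bar>\<close> allows all powers beyond the second to be dropped. The
  bound is uniform on vertical strips, as moving the contour requires.\<close>

lemma norm_mellin_integrand_le:
  assumes "L \<ge> 1" "M \<ge> 2" "0 < Re u" "Re u \<le> B" "1 \<le> \<bar>Im u\<bar>"
  shows "cmod (mellin_integrand L M y u) \<le> exp (\<bar>y\<bar> * B) / (Im u)\<^sup>2"
proof -
  have LM: "2 \<le> L * M" using assms mult_le_mono[of 1 L 2 M] by simp
  have "(Im u)\<^sup>2 \<le> (cmod u)\<^sup>2" by (simp add: cmod_power2)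
  also have "\<dots> \<le> cmod u ^ (L * M)"
    using LM assms abs_Im_le_cmod[of u] by (intro power_increasing) auto
  also have "\<dots> \<le> cmod (pochhammer u L) ^ M"
    unfolding power_mult using assms by (intro power_mono norm_pochhammer_ge) auto
  finally have 1: "(Im u)\<^sup>2 \<le> cmod (pochhammer u L) ^ M" .
  have "- (y * Re u) \<le> \<bar>y * Re u\<bar>" by simp
  also have "\<dots> \<le> \<bar>y\<bar> * B" unfolding abs_mult using assms by (intro mult_left_mono) auto
  finally have 2: "cmod (exp (- (of_real y * u))) \<le> exp (\<bar>y\<bar> * B)" by simp
  have "0 < (Im u)\<^sup>2" using assms by auto
  thus ?thesis unfolding mellin_integrand_def norm_divide norm_power
    using 1 2 by (intro frac_le) auto
qed

text \<open>For \<open>v = 0\<close> the point \<open>b\<close> is a saddle point of the integrand: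
  the linear phase produced by \<open>y\<close> cancels that of \<open>pochhammer u L ^ M\<close>.
  In \<open>normalized_cf\<close> this cancellation takes the form of the factors
  \<open>exp (\<i> * e)\<close>; the displacement \<open>v\<close> leaves
  \<open>exp (- \<i> * \<xi> * v)\<close>.\<close>

lemma mellin_integrand_vertical:
  assumes "L \<ge> 1" "M \<ge> 1" "b > 0" and y: "y = v * spread L M b - real M * (\<Sum>m<L. 1 / (b + real m))"
  shows "mellin_integrand L M y (Complex b (\<xi> / spread L M b))
    = of_real (exp (- (y * b)) / pochhammer b L ^ M) * (normalized_cf L M b \<xi> * exp (- \<i> * of_real (\<xi> * v)))"
proof -
  define s where "s = spread L M b"
  have s: "s > 0" using spread_pos assms by (auto simp: s_def)
  define e where "e = (\<lambda>m. \<xi> / (s * (b + real m)))"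
  have "pochhammer (Complex b (\<xi> / s)) L = (\<Prod>m<L. Complex b (\<xi> / s) + of_nat m)"
    by (simp add: pochhammer_prod atLeast0LessThan)
  also have "\<dots> = (\<Prod>m<L. of_real (b + real m) * (1 + \<i> * of_real (e m)))"
  proof (rule prod.cong)
    fix m assume "m \<in> {..<L}"
    have "b + real m \<noteq> 0" using assms by linarith
    thus "Complex b (\<xi> / s) + of_nat m = of_real (b + real m) * (1 + \<i> * of_real (e m))"
      using s by (simp add: complex_eq_iff e_def)
  qed simp
  also have "\<dots> = of_real (pochhammer b L) * (\<Prod>m<L. 1 + \<i> * of_real (e m))"
    by (simp add: prod.distrib pochhammer_prod atLeast0LessThan)
  finally have poch: "pochhammer (Complex b (\<xi> / s)) L = \<dots>" .
  have "exp (- (of_real y * Complex b (\<xi> / s))) = exp (of_real (- (y * b)) + \<i> * of_real (- (y * \<xi> / s)))"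
    by (simp add: complex_eq_iff algebra_simps exp_eq_polar)
  also have "- (y * \<xi> / s) = real M * (\<Sum>m<L. e m) - \<xi> * v"
  proof -
    have "(\<Sum>m<L. e m) = \<xi> / s * (\<Sum>m<L. 1 / (b + real m))"
      by (simp add: e_def sum_distrib_left)
    thus ?thesis using s by (simp add: y field_simps flip: s_def)
  qed
  also have "exp (of_real (- (y * b)) + \<i> * of_real (real M * (\<Sum>m<L. e m) - \<xi> * v))
     = of_real (exp (- (y * b))) * ((\<Prod>m<L. exp (\<i> * of_real (e m))) ^ M * exp (- \<i> * of_real (\<xi> * v)))"
  proof -
    have "(\<Prod>m<L. exp (\<i> * of_real (e m))) ^ M = exp (\<i> * of_real (real M * (\<Sum>m<L. e m)))"
      by (simp add: exp_sum[symmetric] exp_of_nat_mult[symmetric] sum_distrib_left mult_ac)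
    thus ?thesis by (simp add: exp_add exp_diff exp_minus right_diff_distrib field_simps flip: exp_of_real)
  qed
  finally have "exp (- (of_real y * Complex b (\<xi> / s))) = \<dots>" .
  thus ?thesis unfolding mellin_integrand_def s_def[symmetric] poch
    by (simp add: normalized_cf_def Let_def e_def s_def prod_dividef power_divide power_mult_distrib)
qed

text \<open>Every \<open>b > 0\<close> represents the same weight. The choice of \<open>b\<close>
  decides which summand of the kernel gets normalized, and \<open>v\<close> measures the distance of
  \<open>2 * ln (cmod z)\<close> from the matching mean in standard deviations.\<close>

lemma weight_eq_fourier_integral:
  assumes "L \<ge> 1" "M \<ge> 2" "b > 0" "c > 0" "z \<noteq> 0"
    and y: "2 * ln (cmod z) = v * spread L M b - real M * (\<Sum>m<L. 1 / (b + real m))"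
  shows "weight c L M z = of_real (cmod z powr (- (2 * b)) / (2 * pi * spread L M b * pochhammer b L ^ M))
    * (\<integral>\<xi>. normalized_cf L M b \<xi> * exp (- \<i> * of_real (\<xi> * v)) \<partial>lborel)"
proof -
  define s where "s = spread L M b"
  define r where "r = cmod z"
  have s: "s > 0" using spread_pos assms by (auto simp: s_def)
  have r: "r > 0" using assms by (simp add: r_def)
  define y where "y = 2 * ln r"
  define A where "A = complex_of_real (exp (- (y * b)) / pochhammer b L ^ M)"
  define h where "h = (\<lambda>\<xi>. normalized_cf L M b \<xi> * exp (- \<i> * of_real (\<xi> * v)))"
  define f where "f = (\<lambda>u. 1 / (2 * of_real pi * \<i>) * mellin_integrand L M y (- u))"
  have h_int: "integrable lborel h"
    by (rule Bochner_Integration.integrable_bound[OF integrable_normalized_cf[of L M b]])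
       (use assms in \<open>auto simp: h_def norm_mult\<close>)
  \<comment> \<open>The point at height \<open>t\<close> on the line through \<open>- b\<close> has
    \<open>u = b - \<i> * t\<close>, that is \<open>\<xi> = - s * t\<close>. The shape
    \<open>0 + (- s) * t\<close> is the one of the affine substitution rules for
    \<open>lborel\<close>.\<close>
  have f_line: "f (Complex (- b) t) = A / (2 * of_real pi * \<i>) * h (0 + (- s) * t)" for t
  proof -
    have "mellin_integrand L M y (Complex b ((- s * t) / s)) = A * h (- s * t)"
      unfolding A_def h_def s_def
      by (rule mellin_integrand_vertical) (use assms in \<open>auto simp: y_def r_def\<close>)
    moreover have "- Complex (- b) t = Complex b ((- s * t) / s)" using s by (simp add: complex_eq_iff)
    ultimately show ?thesis by (simp add: f_def)
  qed
  have f_int: "integrable lborel (\<lambda>t. f (Complex (- b) t))"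
    unfolding f_line using s by (intro integrable_mult_right lborel_integrable_real_affine h_int) auto
  have "(\<integral>t. f (Complex (- b) t) \<partial>lborel) = A / (2 * of_real pi * \<i>) * (\<integral>t. h (0 + (- s) * t) \<partial>lborel)"
    unfolding f_line by (rule integral_mult_right_zero)
  also have "(\<integral>t. h (0 + (- s) * t) \<partial>lborel) = (\<integral>t. h t \<partial>lborel) / of_real s"
    using lborel_integral_real_affine[of "- s" h 0] s by (simp add: scaleR_conv_of_real)
  finally have I: "\<i> * (\<integral>t. f (Complex (- b) t) \<partial>lborel)
     = A / (2 * of_real pi * of_real s) * (\<integral>t. h t \<partial>lborel)" by simp
  have "((\<lambda>T. contour_integral (linepath (Complex (- b) (- T)) (Complex (- b) T)) f)
      \<longlongrightarrow> A / (2 * of_real pi * of_real s) * (\<integral>t. h t \<partial>lborel)) at_top"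
    using tendsto_vertical_contour_integral[OF f_int] unfolding I .
  hence lim: "((\<lambda>T. contour_integral (linepath (Complex (- c) (- T)) (Complex (- c) T)) f)
      \<longlongrightarrow> A / (2 * of_real pi * of_real s) * (\<integral>t. h t \<partial>lborel)) at_top"
  proof (rule vertical_line_shift[rotated -1])
    show "f holomorphic_on {s. Re s < 0}"
      unfolding f_def by (intro holomorphic_on_mult holomorphic_mellin_integrand holomorphic_on_const)
    show "cmod (f u) \<le> (exp (\<bar>y\<bar> * max b c) / (2 * pi)) / (Im u)\<^sup>2"
      if "Re u \<in> closed_segment (- b) (- c)" "1 \<le> \<bar>Im u\<bar>" for u
    proof -
      have "0 < Re (- u)" "Re (- u) \<le> max b c"
        using that assms by (auto simp: closed_segment_eq_real_ivl split: if_splits)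
      hence "cmod (mellin_integrand L M y (- u)) \<le> exp (\<bar>y\<bar> * max b c) / (Im (- u))\<^sup>2"
        using assms that by (intro norm_mellin_integrand_le) auto
      thus ?thesis by (simp add: f_def norm_mult norm_divide field_simps)
    qed
  qed (use assms in auto)
  have "contour_integral (linepath (Complex (- c) (- T)) (Complex (- c) T))
       (\<lambda>s. 1 / (2 * of_real pi * \<i>) *
            (Gamma (- s) ^ M / Gamma (of_nat L - s) ^ M) * of_real (cmod z) powr (2 * s))
     = contour_integral (linepath (Complex (- c) (- T)) (Complex (- c) T)) f" for T
  proof (rule contour_integral_eq)
    fix u assume "u \<in> path_image (linepath (Complex (- c) (- T)) (Complex (- c) T))"
    hence "Re u = - c" by (auto simp: closed_segment_def complex_eq_iff algebra_simps)
    hence u: "0 < Re (- u)" using assms by simp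
    have "- u \<notin> \<int>\<^sub>\<le>\<^sub>0" using u by (metis nonpos_Ints_cases complex_Re_of_int of_int_0_less_iff not_less)
    hence "pochhammer (- u) L = Gamma (- u + of_nat L) / Gamma (- u)" "Gamma (- u) \<noteq> 0"
      by (simp_all add: pochhammer_Gamma Gamma_eq_zero_iff)
    hence "Gamma (- u) ^ M / Gamma (of_nat L - u) ^ M = 1 / pochhammer (- u) L ^ M"
      by (simp add: power_divide)
    moreover have "of_real (cmod z) powr (2 * u) = exp (- (of_real y * (- u)))"
      using r by (simp add: powr_def y_def r_def Ln_of_real mult_ac)
    ultimately show "1 / (2 * of_real pi * \<i>) * (Gamma (- u) ^ M / Gamma (of_nat L - u) ^ M) *
        of_real (cmod z) powr (2 * u) = f u"
      by (simp add: f_def mellin_integrand_def)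
  qed
  hence "weight c L M z = A / (2 * of_real pi * of_real s) * (\<integral>t. h t \<partial>lborel)"
    unfolding weight_def using lim by (intro tendsto_Lim) auto
  also have "A / (2 * of_real pi * of_real s)
      = of_real (cmod z powr (- (2 * b)) / (2 * pi * spread L M b * pochhammer b L ^ M))"
  proof -
    have "exp (- (y * b)) = cmod z powr (- (2 * b))" using r by (simp add: powr_def y_def r_def mult_ac)
    thus ?thesis unfolding A_def s_def by simp
  qed
  finally show ?thesis by (simp add: h_def)
qed

section \<open>Local limit and decay of the summands\<close>

text \<open>By Fourier inversion, the density at \<open>v\<close> of the standardized sum of
  logarithms.\<close>

definition local_density :: "nat \<Rightarrow> nat \<Rightarrow> real \<Rightarrow> real \<Rightarrow> complex" where
  "local_density L M b v =
     (\<integral>\<xi>. normalized_cf L M b \<xi> * exp (- \<i> * of_real (\<xi> * v)) \<partial>lborel) / (2 * of_real pi)"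

text \<open>The factor \<open>exp (- \<i> * \<xi> * v)\<close> has modulus one, so \<open>v\<close>
  disappears from the bound. This is why convergence in \<open>L\<^sup>1\<close> is established: it
  controls all real \<open>v\<close> at once.\<close>

lemma local_density_approx:
  assumes "L \<ge> 1" "M \<ge> 2" "b > 0"
  shows "cmod (local_density L M b v - of_real (exp (- (v\<^sup>2) / 2) / sqrt (2 * pi)))
    \<le> (\<integral>\<xi>. cmod (normalized_cf L M b \<xi> - of_real (exp (- (\<xi>\<^sup>2) / 2))) \<partial>lborel) / (2 * pi)"
proof -
  let ?e = "\<lambda>\<xi>. exp (- \<i> * complex_of_real (\<xi> * v))"
  let ?g = "\<lambda>\<xi>. complex_of_real (exp (- (\<xi>\<^sup>2) / 2))"
  have gint: "integrable lborel (\<lambda>\<xi>. exp (- (\<xi>\<^sup>2) / 2) :: real)"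
    using integrable_mult_right[OF integrable_std_normal_moment[of 0], of "sqrt (2 * pi)"]
    by (simp add: std_normal_density_def)
  have g: "integrable lborel (\<lambda>\<xi>. ?g \<xi> * ?e \<xi>)"
    by (rule Bochner_Integration.integrable_bound[OF gint]) (auto simp: norm_mult)
  have f: "integrable lborel (\<lambda>\<xi>. normalized_cf L M b \<xi> * ?e \<xi>)"
    by (rule Bochner_Integration.integrable_bound[OF integrable_normalized_cf[OF assms]]) (auto simp: norm_mult)
  have "(complex_of_real (sqrt (2 * pi) * exp (- (v\<^sup>2) / 2))) / (2 * of_real pi)
      = of_real (exp (- (v\<^sup>2) / 2) / sqrt (2 * pi))"
  proof -
    have "sqrt (2 * pi) * exp (- (v\<^sup>2) / 2) / (sqrt (2 * pi) * sqrt (2 * pi)) = exp (- (v\<^sup>2) / 2) / sqrt (2 * pi)"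
      by (rule mult_divide_mult_cancel_left) simp
    hence "sqrt (2 * pi) * exp (- (v\<^sup>2) / 2) / (2 * pi) = exp (- (v\<^sup>2) / 2) / sqrt (2 * pi)"
      by (simp only: real_sqrt_mult_self) simp
    from arg_cong[OF this, of complex_of_real] show ?thesis by simp
  qed
  hence "local_density L M b v - of_real (exp (- (v\<^sup>2) / 2) / sqrt (2 * pi))
      = ((\<integral>\<xi>. normalized_cf L M b \<xi> * ?e \<xi> \<partial>lborel) - (\<integral>\<xi>. ?g \<xi> * ?e \<xi> \<partial>lborel)) / (2 * of_real pi)"
    unfolding local_density_def gaussian_fourier_integral by (simp only: diff_divide_distrib)
  hence "local_density L M b v - of_real (exp (- (v\<^sup>2) / 2) / sqrt (2 * pi))
      = (\<integral>\<xi>. normalized_cf L M b \<xi> * ?e \<xi> - ?g \<xi> * ?e \<xi> \<partial>lborel) / (2 * of_real pi)"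
    unfolding Bochner_Integration.integral_diff[OF f g] .
  moreover have "cmod (I / (2 * of_real pi)) = cmod I / (2 * pi)" for I by (simp add: norm_divide norm_mult)
  ultimately have "cmod (local_density L M b v - of_real (exp (- (v\<^sup>2) / 2) / sqrt (2 * pi)))
      = cmod (\<integral>\<xi>. normalized_cf L M b \<xi> * ?e \<xi> - ?g \<xi> * ?e \<xi> \<partial>lborel) / (2 * pi)"
    by (simp only:)
  moreover have "cmod (w * ?e \<xi> - w' * ?e \<xi>) = cmod (w - w')" for w w' \<xi>
  proof -
    have "cmod (?e \<xi>) = 1" by simp
    thus ?thesis by (simp only: norm_mult mult_1_right flip: left_diff_distrib)
  qed
  hence "cmod (\<integral>\<xi>. normalized_cf L M b \<xi> * ?e \<xi> - ?g \<xi> * ?e \<xi> \<partial>lborel)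
      \<le> (\<integral>\<xi>. cmod (normalized_cf L M b \<xi> - ?g \<xi>) \<partial>lborel)"
    using integral_norm_bound[of lborel "\<lambda>\<xi>. normalized_cf L M b \<xi> * ?e \<xi> - ?g \<xi> * ?e \<xi>"]
    by (simp only:)
  ultimately show ?thesis by (simp only:) (rule divide_right_mono, simp_all)
qed

section \<open>Exponential decay away from the dominant summand\<close>

lemma ln_one_plus_le_neg:
  assumes "-1 < t" "t \<le> (0::real)"
  shows "ln (1 + t) \<le> t - t\<^sup>2 / 2"
proof -
  let ?f = "\<lambda>x::real. x - x\<^sup>2 / 2 - ln (1 + x)"
  have "?f 0 \<le> ?f t"
  proof (rule DERIV_nonpos_imp_nonincreasing[OF assms(2)])
    fix x assume x: "t \<le> x" "x \<le> 0"
    have "(?f has_real_derivative 1 - x - 1 / (1 + x)) (at x)"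
      using x assms by (auto intro!: derivative_eq_intros simp: field_simps)
    moreover have "1 - x - 1 / (1 + x) \<le> 0"
      using x assms by (simp add: field_simps)
    ultimately show "\<exists>y. (?f has_real_derivative y) (at x) \<and> y \<le> 0" by blast
  qed
  thus ?thesis by simp
qed

text \<open>For \<open>t > 0\<close> the polynomial \<open>t - t\<^sup>2 / 2\<close> lies below the
  logarithm, so the quadratic term has to be damped by \<open>1 + t\<close>.\<close>

lemma ln_one_plus_le_pos:
  assumes "0 \<le> (t::real)"
  shows "ln (1 + t) \<le> t - t\<^sup>2 / (2 * (1 + t))"
proof -
  let ?f = "\<lambda>x::real. (x - x\<^sup>2 / (2 * (1 + x))) - ln (1 + x)"
  have "?f 0 \<le> ?f t"
  proof (rule DERIV_nonneg_imp_nondecreasing[OF assms])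
    fix x :: real assume x: "0 \<le> x" "x \<le> t"
    have "(?f has_real_derivative 1 - (2 * x * (2 * (1 + x)) - x\<^sup>2 * 2) / (2 * (1 + x))\<^sup>2 - 1 / (1 + x)) (at x)"
      using x by (auto intro!: derivative_eq_intros simp: power2_eq_square)
    also have "1 - (2 * x * (2 * (1 + x)) - x\<^sup>2 * 2) / (2 * (1 + x))\<^sup>2 - 1 / (1 + x) = x\<^sup>2 / (2 * (1 + x)\<^sup>2)"
      using x by (simp add: divide_simps) (simp add: algebra_simps power2_eq_square)
    finally have "(?f has_real_derivative x\<^sup>2 / (2 * (1 + x)\<^sup>2)) (at x)" .
    moreover have "0 \<le> x\<^sup>2 / (2 * (1 + x)\<^sup>2)" by simp
    ultimately show "\<exists>y. (?f has_real_derivative y) (at x) \<and> 0 \<le> y" by blast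
  qed
  thus ?thesis by simp
qed

text \<open>Sharpens \<open>1 + t \<le> exp t\<close> by a second-order gain, weakened from
  \<open>d\<^sup>2\<close> to \<open>\<bar>d\<bar>\<close> so that the sum over \<open>d\<close>
  becomes a geometric series. The constant 4 comes from \<open>d \<ge> 1\<close>, where the claim
  reduces to \<open>x + d \<le> 2 * d * x\<close>; negative \<open>d\<close> would allow 2.\<close>

lemma one_plus_quotient_le_exp:
  fixes x d :: real
  assumes "1 \<le> x" "1 \<le> x + d" "1 \<le> \<bar>d\<bar>"
  shows "(x + d) / x \<le> exp (d / x - \<bar>d\<bar> / (4 * x\<^sup>2))"
proof -
  have pos: "0 < 1 + d / x" using assms by (simp add: field_simps)
  have "ln (1 + d / x) \<le> d / x - \<bar>d\<bar> / (4 * x\<^sup>2)"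
  proof (cases "0 \<le> d")
    case True
    have "x + d \<le> 2 * d * x"
    proof -
      have "d * 1 \<le> d * x" "1 * x \<le> d * x" using assms True by (intro mult_left_mono mult_right_mono; simp)+
      thus ?thesis by linarith
    qed
    hence "d / (4 * x\<^sup>2) \<le> d\<^sup>2 / (2 * (x * (x + d)))"
      using assms True by (simp add: divide_simps power2_eq_square)
    also have "\<dots> = (d / x)\<^sup>2 / (2 * (1 + d / x))"
      using assms True by (simp add: divide_simps power2_eq_square)
    finally show ?thesis using ln_one_plus_le_pos[of "d / x"] assms True by simp
  next
    case False
    have "\<bar>d\<bar> / (4 * x\<^sup>2) \<le> d\<^sup>2 / (2 * x\<^sup>2)"
    proof -
      have "\<bar>d\<bar> * 1 \<le> \<bar>d\<bar> * \<bar>d\<bar>" using assms by (intro mult_left_mono) auto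
      thus ?thesis using assms by (simp add: divide_simps power2_eq_square)
    qed
    hence "\<bar>d\<bar> / (4 * x\<^sup>2) \<le> (d / x)\<^sup>2 / 2" by (simp add: power_divide)
    moreover have "ln (1 + d / x) \<le> d / x - (d / x)\<^sup>2 / 2"
      using pos False assms by (intro ln_one_plus_le_neg) (auto simp: divide_nonpos_pos)
    ultimately show ?thesis by linarith
  qed
  hence "1 + d / x \<le> exp (d / x - \<bar>d\<bar> / (4 * x\<^sup>2))" using pos by (metis exp_le_cancel_iff exp_ln)
  thus ?thesis using assms by (simp add: add_divide_distrib)
qed

text \<open>Convexity of \<open>ln \<Gamma>(x) - ln \<Gamma>(x + L)\<close> in \<open>x\<close>: away from the index at which the mean of the
  summand is matched, the summands of the kernel decay geometrically with ratio
  \<open>exp (- s\<^sup>2/4 + O(s))\<close>.\<close>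

lemma pochhammer_ratio_le:
  fixes b d y w :: real
  assumes "M \<ge> 1" "1 \<le> b" "1 \<le> b + d" "1 \<le> \<bar>d\<bar>"
    and y: "y = w * spread L M b - real M * (\<Sum>m<L. 1 / (b + real m))" and w: "\<bar>w\<bar> \<le> B"
  shows "(pochhammer (b + d) L / pochhammer b L) ^ M * exp (d * y)
    \<le> exp (- ((spread L M b)\<^sup>2 / 4 - spread L M b * B)) powr \<bar>d\<bar>"
proof -
  define s where "s = spread L M b"
  have s0: "0 \<le> s" by (simp add: s_def spread_def sum_nonneg)
  have "pochhammer (b + d) L / pochhammer b L = (\<Prod>m<L. (b + real m + d) / (b + real m))"
    by (simp add: pochhammer_prod atLeast0LessThan prod_dividef add_ac)
  also have "\<dots> \<le> (\<Prod>m<L. exp (d / (b + real m) - \<bar>d\<bar> / (4 * (b + real m)\<^sup>2)))"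
    using assms by (intro prod_mono conjI one_plus_quotient_le_exp divide_nonneg_nonneg) auto
  also have "\<dots> = exp (\<Sum>m<L. d / (b + real m) - \<bar>d\<bar> / (4 * (b + real m)\<^sup>2))" by (simp add: exp_sum)
  finally have "(pochhammer (b + d) L / pochhammer b L) ^ M
      \<le> exp (\<Sum>m<L. d / (b + real m) - \<bar>d\<bar> / (4 * (b + real m)\<^sup>2)) ^ M"
    using assms by (intro power_mono divide_nonneg_nonneg) (auto simp: pochhammer_nonneg)
  also have "\<dots> = exp (real M * (\<Sum>m<L. d / (b + real m) - \<bar>d\<bar> / (4 * (b + real m)\<^sup>2)))"
    by (simp add: exp_of_nat_mult)
  also have "real M * (\<Sum>m<L. d / (b + real m) - \<bar>d\<bar> / (4 * (b + real m)\<^sup>2))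
      = d * (real M * (\<Sum>m<L. 1 / (b + real m))) - \<bar>d\<bar> / 4 * (real M * (\<Sum>m<L. 1 / (b + real m)\<^sup>2))"
    by (simp add: sum_subtractf sum_distrib_left right_diff_distrib mult_ac)
  also have "real M * (\<Sum>m<L. 1 / (b + real m)\<^sup>2) = s\<^sup>2" by (simp add: s_def spread_power2)
  finally have "(pochhammer (b + d) L / pochhammer b L) ^ M * exp (d * y)
      \<le> exp (d * (real M * (\<Sum>m<L. 1 / (b + real m))) - \<bar>d\<bar> / 4 * s\<^sup>2) * exp (d * y)"
    by (intro mult_right_mono) auto
  \<comment> \<open>The first-order sum cancels against the mean contained in \<open>d * y\<close>;
    of the first-order terms only the displacement \<open>d * w * s\<close> remains.\<close>
  also have "\<dots> = exp (d * w * s - \<bar>d\<bar> / 4 * s\<^sup>2)"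
    by (simp add: y s_def algebra_simps flip: exp_add)
  also have "\<dots> \<le> exp (\<bar>d\<bar> * (- (s\<^sup>2 / 4 - s * B)))"
  proof -
    have "d * w \<le> \<bar>d\<bar> * B"
      using mult_left_mono[OF w abs_ge_zero[of d]] abs_ge_self[of "d * w"] by (simp add: abs_mult)
    hence "d * w * s \<le> \<bar>d\<bar> * B * s" using s0 by (rule mult_right_mono)
    thus ?thesis by (simp add: algebra_simps)
  qed
  also have "\<dots> = exp (- (s\<^sup>2 / 4 - s * B)) powr \<bar>d\<bar>" by (simp add: powr_def)
  finally show ?thesis by (simp add: s_def)
qed

lemma sum_powers_le:
  fixes q :: real
  assumes "0 \<le> q" "q < 1" "finite I" "0 \<notin> I"
  shows "(\<Sum>i\<in>I. q ^ i) \<le> q / (1 - q)"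
proof -
  have "(\<Sum>i\<in>insert 0 I. q ^ i) \<le> (\<Sum>i. q ^ i)"
    using assms by (intro sum_le_suminf) (auto intro: summable_geometric)
  hence "1 + (\<Sum>i\<in>I. q ^ i) \<le> 1 / (1 - q)" using assms by (simp add: suminf_geometric)
  thus ?thesis using assms by (simp add: field_simps)
qed

text \<open>On either side of \<open>k\<close> the exponents are distinct and positive, so each side
  contributes at most \<open>q / (1 - q)\<close>.\<close>

lemma two_sided_geometric_le:
  fixes q :: real
  assumes "0 \<le> q" "q < 1"
  shows "(\<Sum>j\<in>{..<N} - {k}. q ^ (if j < k then k - j else j - k)) \<le> 2 * q / (1 - q)"
proof -
  let ?A = "{j. j < N \<and> j < k}" and ?B = "{j. j < N \<and> k < j}"
  have "(\<Sum>j\<in>?A. q ^ (k - j)) = (\<Sum>i\<in>(\<lambda>j. k - j) ` ?A. q ^ i)"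
    by (subst sum.reindex) (auto simp: inj_on_def)
  also have "\<dots> \<le> q / (1 - q)" using assms by (intro sum_powers_le) auto
  finally have A: "(\<Sum>j\<in>?A. q ^ (k - j)) \<le> q / (1 - q)" .
  have "(\<Sum>j\<in>?B. q ^ (j - k)) = (\<Sum>i\<in>(\<lambda>j. j - k) ` ?B. q ^ i)"
    by (subst sum.reindex) (auto simp: inj_on_def)
  also have "\<dots> \<le> q / (1 - q)" using assms by (intro sum_powers_le) auto
  finally have B: "(\<Sum>j\<in>?B. q ^ (j - k)) \<le> q / (1 - q)" .
  let ?f = "\<lambda>j. q ^ (if j < k then k - j else j - k)"
  have eq: "{..<N} - {k} = ?A \<union> ?B" by auto
  have "finite ?A" "finite ?B" "?A \<inter> ?B = {}" by auto
  hence "sum ?f ({..<N} - {k}) = sum ?f ?A + sum ?f ?B"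
    unfolding eq by (rule sum.union_disjoint)
  also have "sum ?f ?A = (\<Sum>j\<in>?A. q ^ (k - j))" by (rule sum.cong) auto
  also have "sum ?f ?B = (\<Sum>j\<in>?B. q ^ (j - k))" by (rule sum.cong) auto
  finally show ?thesis using A B by simp
qed

text \<open>Nonnegative scaling respects the principal branch. Hence the exponential prefactors of
  the weights can be taken out of the square root exactly, before any estimate.\<close>

lemma csqrt_of_real_power2_mult: "0 \<le> x \<Longrightarrow> csqrt (of_real (x\<^sup>2) * w) = of_real x * csqrt w"
  using csqrt_principal[of w]
  by (cases "x = 0") (auto intro!: csqrt_unique simp: power_mult_distrib)

text \<open>Factor \<open>w - x\<^sup>2\<close> as \<open>(csqrt w - x) * (csqrt w + x)\<close>. The
  principal root has nonnegative real part, so the second factor has modulus at least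
  \<open>x\<close>, even when \<open>w\<close> lies on or across the branch cut.\<close>

lemma norm_csqrt_diff_le:
  assumes "0 < x"
  shows "cmod (csqrt w - of_real x) \<le> cmod (w - of_real (x\<^sup>2)) / x"
proof -
  have "x \<le> Re (csqrt w + of_real x)" using csqrt_principal[of w] by auto
  also have "\<dots> \<le> cmod (csqrt w + of_real x)" by (rule complex_Re_le_cmod)
  finally have "cmod (csqrt w - of_real x) * x \<le> cmod (csqrt w - of_real x) * cmod (csqrt w + of_real x)"
    by (intro mult_left_mono) auto
  also have "\<dots> = cmod ((csqrt w)\<^sup>2 - (of_real x)\<^sup>2)"
    by (simp only: norm_mult[symmetric] power2_eq_square) (simp add: algebra_simps)
  also have "\<dots> = cmod (w - of_real (x\<^sup>2))" by simp
  finally show ?thesis using assms by (simp add: field_simps)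
qed

section \<open>The rescaled kernel\<close>

lemma truncated_kernel_summand:
  "Gamma (of_nat (L + j + 1)) ^ M / Gamma (of_nat (j + 1)) ^ M = complex_of_real (pochhammer (real (j + 1)) L ^ M)"
proof -
  have "complex_of_nat (j + 1) \<notin> \<int>\<^sub>\<le>\<^sub>0" by (simp only: of_nat_in_nonpos_Ints_iff)
  hence "pochhammer (complex_of_nat (j + 1)) L = Gamma (of_nat (j + 1) + of_nat L) / Gamma (of_nat (j + 1))"
    by (rule pochhammer_Gamma)
  moreover have "complex_of_nat (j + 1) + of_nat L = of_nat (L + j + 1)" by simp
  moreover have "pochhammer (complex_of_nat (j + 1)) L = of_real (pochhammer (real (j + 1)) L)"
    using pochhammer_of_real[of "real (j + 1)" L, where 'a = complex] by (simp only: of_real_of_nat_eq)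
  ultimately show ?thesis by (simp only: power_divide[symmetric] of_real_power)
qed

text \<open>Since \<open>y\<close> is affine, the moduli of the two points enter only through the
  value of \<open>y\<close> at the midpoint \<open>(v1 + v2) / 2\<close>. The prefactors are
  arranged so that the summand \<open>j = b - 1\<close> becomes exactly 1, and
  \<open>1 / (2 * pi)\<close> combines \<open>1 / pi\<close> from the kernel with the half of
  \<open>s / 2\<close>.\<close>

lemma scaled_kernel_eq:
  fixes L M N b :: nat and v1 v2 \<alpha>1 \<alpha>2 c :: real
  assumes "L \<ge> 1" "M \<ge> 2" "1 \<le> b" "c > 0"
  defines "s \<equiv> spread L M b"
  defines "y \<equiv> \<lambda>v. v * s - real M * (\<Sum>m<L. 1 / (real b + real m))"
  defines "z1 \<equiv> of_real (exp (y v1 / 2)) * cis \<alpha>1" and "z2 \<equiv> of_real (exp (y v2 / 2)) * cis \<alpha>2"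
  shows "of_real (s / 2) * (of_real (cmod z1) * cis (- ((real b - 1) * \<alpha>1))) *
      (of_real (cmod z2) * cis ((real b - 1) * \<alpha>2)) * truncated_kernel c L M N z1 z2
    = csqrt (local_density L M b v1 * local_density L M b v2) / (2 * of_real pi) *
      (\<Sum>j<N. of_real ((pochhammer (real (j + 1)) L / pochhammer (real b) L) ^ M
          * exp ((real (j + 1) - real b) * y ((v1 + v2) / 2)))
          * cis ((real (j + 1) - real b) * (\<alpha>1 - \<alpha>2)))"
proof -
  define P where "P = pochhammer (real b) L ^ M"
  define Y where "Y = y ((v1 + v2) / 2)"
  \<comment> \<open>The geometric mean of the positive prefactors of the two weights.\<close>
  define x where "x = exp (- (real b * Y)) / (s * P)"
  define gg where "gg = csqrt (local_density L M b v1 * local_density L M b v2)"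
  have s: "s > 0" using spread_pos assms by (auto simp: s_def)
  have P: "P > 0" unfolding P_def using assms by (intro zero_less_power pochhammer_pos) auto
  have Y: "Y = (y v1 + y v2) / 2" by (simp add: Y_def y_def field_simps)
  have w: "weight c L M (of_real (exp (y v / 2)) * cis \<alpha>)
      = of_real (exp (- (real b * y v)) / (s * P)) * local_density L M b v" for v \<alpha>
  proof -
    let ?z = "of_real (exp (y v / 2)) * cis \<alpha>"
    have cz: "cmod ?z = exp (y v / 2)" by (simp only: norm_mult norm_of_real norm_cis) simp
    have lz: "2 * ln (cmod ?z) = y v" unfolding cz by simp
    have "weight c L M ?z = of_real (cmod ?z powr (- (2 * real b)) / (2 * pi * spread L M b * pochhammer (real b) L ^ M))
       * (\<integral>\<xi>. normalized_cf L M b \<xi> * exp (- \<i> * of_real (\<xi> * v)) \<partial>lborel)"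
      by (rule weight_eq_fourier_integral) (use assms(1-4) lz in \<open>auto simp: y_def s_def\<close>)
    also have "cmod ?z powr (- (2 * real b)) = exp (- (real b * y v))"
      unfolding cz by (simp add: powr_def)
    finally show ?thesis by (simp add: local_density_def s_def P_def)
  qed
  have "csqrt (weight c L M z1 * weight c L M z2) = csqrt (of_real (x\<^sup>2) * (local_density L M b v1 * local_density L M b v2))"
  proof -
    have "x\<^sup>2 = (exp (- (real b * y v1)) / (s * P)) * (exp (- (real b * y v2)) / (s * P))"
    proof -
      have "exp (- (real b * Y)) * exp (- (real b * Y)) = exp (- (real b * y v1)) * exp (- (real b * y v2))"
        unfolding exp_add[symmetric] by (simp add: Y field_simps)
      thus ?thesis by (simp add: x_def power2_eq_square)
    qed
    thus ?thesis unfolding z1_def z2_def w by (simp add: mult_ac)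
  qed
  also have "\<dots> = of_real x * gg"
    unfolding gg_def using s P by (intro csqrt_of_real_power2_mult) (simp add: x_def)
  finally have csq: "csqrt (weight c L M z1 * weight c L M z2) = of_real x * gg" .
  have zz: "(z1 * cnj z2) ^ j = of_real (exp (real j * Y)) * cis (real j * (\<alpha>1 - \<alpha>2))" for j
  proof -
    have "z1 * cnj z2 = of_real (exp (y v1 / 2) * exp (y v2 / 2)) * (cis \<alpha>1 * cis (- \<alpha>2))"
      unfolding z1_def z2_def by (simp add: cis_cnj del: of_real_exp)
    also have "exp (y v1 / 2) * exp (y v2 / 2) = exp Y"
      by (simp add: Y add_divide_distrib exp_add)
    finally have "z1 * cnj z2 = of_real (exp Y) * cis (\<alpha>1 - \<alpha>2)" by (simp add: cis_mult)
    thus ?thesis by (simp add: power_mult_distrib Complex.DeMoivre exp_of_nat_mult del: of_real_exp)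
  qed
  have nz: "cmod z1 * cmod z2 = exp Y"
  proof -
    have "cmod (of_real (exp a) * cis \<alpha>) = exp a" for a \<alpha>
      by (simp only: norm_mult norm_of_real norm_cis) simp
    thus ?thesis unfolding z1_def z2_def by (simp only: exp_add[symmetric] Y add_divide_distrib)
  qed
  have "of_real (s / 2) * (of_real (cmod z1) * cis (- ((real b - 1) * \<alpha>1))) *
      (of_real (cmod z2) * cis ((real b - 1) * \<alpha>2)) * truncated_kernel c L M N z1 z2
     = of_real (s / 2) * of_real (cmod z1 * cmod z2) * (cis (- ((real b - 1) * \<alpha>1)) * cis ((real b - 1) * \<alpha>2))
       * truncated_kernel c L M N z1 z2" by simp
  also have "cis (- ((real b - 1) * \<alpha>1)) * cis ((real b - 1) * \<alpha>2) = cis (- ((real b - 1) * (\<alpha>1 - \<alpha>2)))"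
    by (simp add: cis_mult algebra_simps)
  also have "of_real (s / 2) * of_real (cmod z1 * cmod z2) * cis (- ((real b - 1) * (\<alpha>1 - \<alpha>2)))
       * truncated_kernel c L M N z1 z2
     = gg / (2 * of_real pi) * (\<Sum>j<N. of_real (s * exp Y * x) * cis (- ((real b - 1) * (\<alpha>1 - \<alpha>2))) *
         (of_real (pochhammer (real (j + 1)) L ^ M) * (of_real (exp (real j * Y)) * cis (real j * (\<alpha>1 - \<alpha>2)))))"
    unfolding truncated_kernel_def csq nz truncated_kernel_summand zz sum_distrib_left
    by (intro sum.cong refl) (simp add: mult_ac)
  also have "(\<Sum>j<N. of_real (s * exp Y * x) * cis (- ((real b - 1) * (\<alpha>1 - \<alpha>2))) *
         (of_real (pochhammer (real (j + 1)) L ^ M) * (of_real (exp (real j * Y)) * cis (real j * (\<alpha>1 - \<alpha>2)))))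
     = (\<Sum>j<N. of_real ((pochhammer (real (j + 1)) L / pochhammer (real b) L) ^ M
          * exp ((real (j + 1) - real b) * Y)) * cis ((real (j + 1) - real b) * (\<alpha>1 - \<alpha>2)))"
  proof (intro sum.cong refl)
    fix j
    have 1: "cis (- ((real b - 1) * (\<alpha>1 - \<alpha>2))) * cis (real j * (\<alpha>1 - \<alpha>2)) = cis ((real (j + 1) - real b) * (\<alpha>1 - \<alpha>2))"
      by (simp add: cis_mult algebra_simps)
    have "exp Y * exp (- (real b * Y)) * exp (real j * Y) = exp ((real (j + 1) - real b) * Y)"
      by (simp add: exp_add[symmetric] algebra_simps)
    hence e: "exp ((real (j + 1) - real b) * Y) = exp Y * exp (- (real b * Y)) * exp (real j * Y)" by simp
    have 2: "s * exp Y * x * (pochhammer (real (j + 1)) L ^ M * exp (real j * Y))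
        = (pochhammer (real (j + 1)) L / pochhammer (real b) L) ^ M * exp ((real (j + 1) - real b) * Y)"
      unfolding e power_divide P_def[symmetric] x_def using s by simp
    show "of_real (s * exp Y * x) * cis (- ((real b - 1) * (\<alpha>1 - \<alpha>2))) *
         (of_real (pochhammer (real (j + 1)) L ^ M) * (of_real (exp (real j * Y)) * cis (real j * (\<alpha>1 - \<alpha>2))))
      = of_real ((pochhammer (real (j + 1)) L / pochhammer (real b) L) ^ M
          * exp ((real (j + 1) - real b) * Y)) * cis ((real (j + 1) - real b) * (\<alpha>1 - \<alpha>2))"
      unfolding 1[symmetric] 2[symmetric] by (simp add: mult_ac)
  qed
  finally show ?thesis unfolding gg_def Y_def .
qed

lemma scaled_kernel_approx:
  fixes L M N b :: nat and v1 v2 \<alpha>1 \<alpha>2 c B :: real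
  assumes "L \<ge> 1" "M \<ge> 2" "1 \<le> b" "b \<le> N" "c > 0" "\<bar>v1\<bar> \<le> B" "\<bar>v2\<bar> \<le> B"
  defines "s \<equiv> spread L M b"
  defines "y \<equiv> \<lambda>v. v * s - real M * (\<Sum>m<L. 1 / (real b + real m))"
  defines "q \<equiv> exp (- (s\<^sup>2 / 4 - s * B))"
  defines "z1 \<equiv> of_real (exp (y v1 / 2)) * cis \<alpha>1" and "z2 \<equiv> of_real (exp (y v2 / 2)) * cis \<alpha>2"
  defines "gg \<equiv> csqrt (local_density L M b v1 * local_density L M b v2)"
  assumes q: "q < 1"
  shows "cmod (of_real (s / 2) * (of_real (cmod z1) * cis (- ((real b - 1) * \<alpha>1))) *
      (of_real (cmod z2) * cis ((real b - 1) * \<alpha>2)) * truncated_kernel c L M N z1 z2 - gg / (2 * of_real pi))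
    \<le> cmod gg / (2 * pi) * (2 * q / (1 - q))"
proof -
  define t where "t = (\<lambda>j. complex_of_real ((pochhammer (real (j + 1)) L / pochhammer (real b) L) ^ M
          * exp ((real (j + 1) - real b) * y ((v1 + v2) / 2)))
          * cis ((real (j + 1) - real b) * (\<alpha>1 - \<alpha>2)))"
  have pb: "pochhammer (real b) L > 0" using assms by (intro pochhammer_pos) auto
  \<comment> \<open>Summand \<open>j\<close> carries \<open>pochhammer (j + 1) L\<close>, so the
    match with \<open>b\<close> occurs at \<open>j = b - 1\<close>; \<open>b \<le> N\<close> puts
    this index in range.\<close>
  have "t (b - 1) = 1"
    using assms pb by (simp add: t_def of_nat_diff)
  moreover have "b - 1 \<in> {..<N}" using assms by simp
  ultimately have "(\<Sum>j<N. t j) = 1 + (\<Sum>j\<in>{..<N} - {b - 1}. t j)"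
    by (subst sum.remove[of _ "b - 1"]) auto
  moreover have "of_real (s / 2) * (of_real (cmod z1) * cis (- ((real b - 1) * \<alpha>1))) *
      (of_real (cmod z2) * cis ((real b - 1) * \<alpha>2)) * truncated_kernel c L M N z1 z2
    = gg / (2 * of_real pi) * (\<Sum>j<N. t j)"
    unfolding z1_def z2_def y_def s_def gg_def t_def by (rule scaled_kernel_eq[OF assms(1,2,3,5)])
  ultimately have "of_real (s / 2) * (of_real (cmod z1) * cis (- ((real b - 1) * \<alpha>1))) *
      (of_real (cmod z2) * cis ((real b - 1) * \<alpha>2)) * truncated_kernel c L M N z1 z2 - gg / (2 * of_real pi)
    = gg / (2 * of_real pi) * (\<Sum>j\<in>{..<N} - {b - 1}. t j)"
    by (simp only: distrib_left mult_1_right add_diff_cancel_left')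
  also have "cmod \<dots> = cmod gg / (2 * pi) * cmod (\<Sum>j\<in>{..<N} - {b - 1}. t j)"
    by (simp add: norm_mult norm_divide)
  also have "\<dots> \<le> cmod gg / (2 * pi) * (2 * q / (1 - q))"
  proof (intro mult_left_mono)
    have "cmod (\<Sum>j\<in>{..<N} - {b - 1}. t j) \<le> (\<Sum>j\<in>{..<N} - {b - 1}. cmod (t j))" by (rule norm_sum)
    also have "\<dots> \<le> (\<Sum>j\<in>{..<N} - {b - 1}. q ^ (if j < b - 1 then b - 1 - j else j - (b - 1)))"
    proof (rule sum_mono)
      fix j assume j: "j \<in> {..<N} - {b - 1}"
      define d where "d = real (j + 1) - real b"
      let ?n = "if j < b - 1 then b - 1 - j else j - (b - 1)"
      have d: "\<bar>d\<bar> = real ?n" "1 \<le> \<bar>d\<bar>" using j assms by (auto simp: d_def of_nat_diff)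
      have "cmod (t j) = (pochhammer (real b + d) L / pochhammer (real b) L) ^ M * exp (d * y ((v1 + v2) / 2))"
      proof -
        have "0 \<le> pochhammer (real b + d) L" by (intro pochhammer_nonneg) (simp add: d_def)
        thus ?thesis using pb by (simp add: t_def norm_mult norm_power norm_divide d_def add.commute)
      qed
      also have "\<dots> \<le> exp (- ((spread L M b)\<^sup>2 / 4 - spread L M b * B)) powr \<bar>d\<bar>"
      proof (rule pochhammer_ratio_le)
        show "y ((v1 + v2) / 2) = (v1 + v2) / 2 * spread L M b - real M * (\<Sum>m<L. 1 / (real b + real m))"
          by (simp only: y_def s_def)
        show "\<bar>(v1 + v2) / 2\<bar> \<le> B" using assms(6,7) by (simp add: abs_le_iff field_simps)
      qed (use assms(1-3) d in \<open>auto simp: d_def\<close>)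
      also have "\<dots> = q ^ ?n"
        unfolding d by (simp add: q_def s_def powr_realpow)
      finally show "cmod (t j) \<le> q ^ ?n" .
    qed
    also have "\<dots> \<le> 2 * q / (1 - q)" using q by (intro two_sided_geometric_le) (auto simp: q_def)
    finally show "cmod (\<Sum>j\<in>{..<N} - {b - 1}. t j) \<le> 2 * q / (1 - q)" .
  qed auto
  finally show ?thesis .
qed

text \<open>The square root is not Lipschitz at 0, so a lower bound for the Gaussian is needed; on
  \<open>\<bar>v\<bar> \<le> B\<close> it yields the factor
  \<open>sqrt (2 * pi) * exp (B\<^sup>2 / 2)\<close>. The 3 is 2 from \<open>cmod g2 \<le> 2\<close>
  plus 1 from the bound on the Gaussian.\<close>

lemma csqrt_local_density_approx:
  fixes v1 v2 B \<delta> :: real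
  assumes "\<bar>v1\<bar> \<le> B" "\<bar>v2\<bar> \<le> B" "\<delta> \<le> 1"
    and g1: "cmod (g1 - of_real (exp (- (v1\<^sup>2) / 2) / sqrt (2 * pi))) \<le> \<delta>"
    and g2: "cmod (g2 - of_real (exp (- (v2\<^sup>2) / 2) / sqrt (2 * pi))) \<le> \<delta>"
  shows "cmod (csqrt (g1 * g2) - of_real (exp (- (v1\<^sup>2 + v2\<^sup>2) / 4) / sqrt (2 * pi)))
    \<le> 3 * \<delta> * (sqrt (2 * pi) * exp (B\<^sup>2 / 2))"
proof -
  define G where "G = (\<lambda>v::real. exp (- (v\<^sup>2) / 2) / sqrt (2 * pi))"
  define h where "h = exp (- (v1\<^sup>2 + v2\<^sup>2) / 4) / sqrt (2 * pi)"
  have h: "0 < h" by (simp add: h_def)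
  have hh: "h\<^sup>2 = G v1 * G v2"
  proof -
    have "(exp (- (v1\<^sup>2 + v2\<^sup>2) / 4))\<^sup>2 = exp (- (v1\<^sup>2) / 2) * exp (- (v2\<^sup>2) / 2)"
      by (simp add: power2_eq_square[of "exp _"] exp_add[symmetric] add_divide_distrib)
    thus ?thesis by (simp add: h_def G_def power_divide)
  qed
  have h1: "1 / h \<le> sqrt (2 * pi) * exp (B\<^sup>2 / 2)"
  proof -
    have "v1\<^sup>2 \<le> B\<^sup>2" "v2\<^sup>2 \<le> B\<^sup>2" using assms by (auto simp: abs_le_square_iff[symmetric])
    hence "exp ((v1\<^sup>2 + v2\<^sup>2) / 4) \<le> exp (B\<^sup>2 / 2)" by simp
    moreover have "1 / h = sqrt (2 * pi) * exp ((v1\<^sup>2 + v2\<^sup>2) / 4)"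
    proof -
      have "exp (- a / 4) = inverse (exp (a / 4))" for a :: real by (simp flip: exp_minus)
      thus ?thesis unfolding h_def by (simp only: inverse_eq_divide) simp
    qed
    ultimately show ?thesis by simp
  qed
  have G: "0 \<le> G v" "G v \<le> 1" for v
  proof -
    have "exp (- (v\<^sup>2) / 2) \<le> 1" by simp
    also have "1 \<le> sqrt (2 * pi)" using pi_ge_two by simp
    finally show "0 \<le> G v" "G v \<le> 1" by (auto simp: G_def)
  qed
  have g1': "cmod (g1 - of_real (G v1)) \<le> \<delta>" and g2': "cmod (g2 - of_real (G v2)) \<le> \<delta>"
    using g1 g2 by (simp_all only: G_def)
  have d0: "0 \<le> \<delta>" using g1 norm_ge_zero order_trans by blast
  have "cmod (csqrt (g1 * g2) - of_real h) \<le> cmod (g1 * g2 - of_real (h\<^sup>2)) / h"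
    by (rule norm_csqrt_diff_le[OF h])
  also have "g1 * g2 - of_real (h\<^sup>2) = (g1 - of_real (G v1)) * g2 + of_real (G v1) * (g2 - of_real (G v2))"
    unfolding hh by (simp add: algebra_simps)
  also have "cmod \<dots> / h \<le> (\<delta> * 2 + 1 * \<delta>) / h"
  proof (intro divide_right_mono order_trans[OF norm_triangle_ineq] add_mono)
    have "cmod g2 \<le> cmod (g2 - of_real (G v2)) + cmod (of_real (G v2))"
      using norm_triangle_ineq[of "g2 - of_real (G v2)" "of_real (G v2)"] by simp
    also have "\<dots> \<le> 1 + 1" using g2' assms(3) G[of v2] by (intro add_mono) auto
    finally show "cmod ((g1 - of_real (G v1)) * g2) \<le> \<delta> * 2"
      unfolding norm_mult using g1' d0 by (intro mult_mono) auto
    show "cmod (of_real (G v1) * (g2 - of_real (G v2))) \<le> 1 * \<delta>"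
      unfolding norm_mult using g2' G[of v1] by (intro mult_mono) auto
  qed (use h in auto)
  also have "\<dots> = 3 * \<delta> * (1 / h)" by simp
  also have "\<dots> \<le> 3 * \<delta> * (sqrt (2 * pi) * exp (B\<^sup>2 / 2))" using h1 d0 by (intro mult_left_mono) auto
  finally show ?thesis by (simp add: h_def)
qed

section \<open>Determinants of uniformly convergent kernels\<close>

text \<open>The unimodular factors cancel in the determinant; they remove the phase of the dominant summand
  \<open>j = b - 1\<close>.\<close>

definition scaled_kernel ::
    "real \<Rightarrow> nat \<Rightarrow> nat \<Rightarrow> nat \<Rightarrow> nat \<Rightarrow> real \<Rightarrow> real \<Rightarrow> real \<Rightarrow> real \<Rightarrow> complex" where
  "scaled_kernel c L M N b v1 v2 \<alpha>1 \<alpha>2 =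
    (let s = spread L M b;
         y = \<lambda>v. v * s - real M * (\<Sum>m<L. 1 / (real b + real m));
         z1 = of_real (exp (y v1 / 2)) * cis \<alpha>1;
         z2 = of_real (exp (y v2 / 2)) * cis \<alpha>2
     in of_real (s / 2) * (of_real (cmod z1) * cis (- ((real b - 1) * \<alpha>1))) *
        (of_real (cmod z2) * cis ((real b - 1) * \<alpha>2)) * truncated_kernel c L M N z1 z2)"

text \<open>Uniformity in the angles is automatic: they enter the remaining summands only through
  factors of modulus one.\<close>

lemma scaled_kernel_limit:
  fixes L M N b :: "nat \<Rightarrow> nat" and B c \<epsilon> :: real
  assumes L: "\<And>l. L l \<ge> 1" and M: "eventually (\<lambda>l. M l \<ge> 2) sequentially"
    and b: "\<And>l. 1 \<le> b l" "\<And>l. b l \<le> N l" and "c > 0" "\<epsilon> > 0"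
    and lim: "filterlim (\<lambda>l. spread (L l) (M l) (b l)) at_top sequentially"
  shows "eventually (\<lambda>l. \<forall>v1 v2 \<alpha>1 \<alpha>2. \<bar>v1\<bar> \<le> B \<longrightarrow> \<bar>v2\<bar> \<le> B \<longrightarrow>
    cmod (scaled_kernel c (L l) (M l) (N l) (b l) v1 v2 \<alpha>1 \<alpha>2
      - of_real (exp (- (v1\<^sup>2 + v2\<^sup>2) / 4) / sqrt (2 * pi) / (2 * pi))) < \<epsilon>) sequentially"
proof -
  define s where "s = (\<lambda>l. spread (L l) (M l) (b l))"
  define \<delta> where "\<delta> = (\<lambda>l. (\<integral>\<xi>. cmod (normalized_cf (L l) (M l) (b l) \<xi> - of_real (exp (- (\<xi>\<^sup>2) / 2))) \<partial>lborel) / (2 * pi))"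
  define q where "q = (\<lambda>l. exp (- ((s l)\<^sup>2 / 4 - s l * B)))"
  \<comment> \<open>\<open>H\<close> bounds the error of the square root of the densities,
    \<open>1 + H\<close> the modulus of that root, and the first term of \<open>E\<close> the
    summands other than \<open>j = b - 1\<close>; the division by \<open>2 * pi\<close> is
    dropped.\<close>
  define H where "H = (\<lambda>l. 3 * \<delta> l * (sqrt (2 * pi) * exp (B\<^sup>2 / 2)))"
  define E where "E = (\<lambda>l. (1 + H l) * (2 * q l / (1 - q l)) + H l)"
  have \<delta>: "\<delta> \<longlonglongrightarrow> 0"
  proof -
    \<comment> \<open>The \<open>L\<^sup>1\<close> limit asks for \<open>M l \<ge> 2\<close> at
      every index, so it is applied to the shifted sequence.\<close>
    obtain l0 where l0: "\<And>l. l0 \<le> l \<Longrightarrow> M l \<ge> 2" using M by (auto simp: eventually_sequentially)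
    have "(\<lambda>l. \<integral>\<xi>. cmod (normalized_cf (L (l + l0)) (M (l + l0)) (b (l + l0)) \<xi> - of_real (exp (- (\<xi>\<^sup>2) / 2))) \<partial>lborel) \<longlonglongrightarrow> 0"
    proof (rule normalized_cf_L1_limit)
      show "filterlim (\<lambda>l. spread (L (l + l0)) (M (l + l0)) (real (b (l + l0)))) at_top sequentially"
        using lim by (rule filterlim_compose) (rule filterlim_add_const_nat_at_top)
    qed (use L l0 b in auto)
    from LIMSEQ_offset[OF this] show ?thesis unfolding \<delta>_def by (rule tendsto_divide_zero)
  qed
  have q: "q \<longlonglongrightarrow> 0"
  proof -
    have s: "filterlim s at_top sequentially" using lim by (simp add: s_def)
    have "filterlim (\<lambda>l. - B + s l * (1 / 4)) at_top sequentially"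
      by (intro filterlim_tendsto_add_at_top[OF tendsto_const] filterlim_at_top_mult_tendsto_pos[OF tendsto_const _ s]) auto
    hence "filterlim (\<lambda>l. s l * (- B + s l * (1 / 4))) at_top sequentially"
      by (intro filterlim_at_top_mult_at_top s)
    also have "(\<lambda>l. s l * (- B + s l * (1 / 4))) = (\<lambda>l. (s l)\<^sup>2 / 4 - s l * B)"
      by (auto simp: power2_eq_square algebra_simps)
    finally show ?thesis unfolding q_def
      by (intro filterlim_compose[OF exp_at_bot] filterlim_compose[OF filterlim_uminus_at_bot_at_top])
  qed
  have H: "H \<longlonglongrightarrow> 0" unfolding H_def
    by (intro tendsto_mult_left_zero tendsto_mult_right_zero \<delta>)
  have "E \<longlonglongrightarrow> (1 + 0) * (2 * 0 / (1 - 0)) + 0"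
    unfolding E_def by (intro tendsto_intros H q) simp
  hence E: "E \<longlonglongrightarrow> 0" by simp
  have ev: "eventually (\<lambda>l. q l < 1) sequentially" "eventually (\<lambda>l. \<delta> l < 1) sequentially"
    "eventually (\<lambda>l. E l < \<epsilon>) sequentially"
    using order_tendstoD(2)[OF q, of 1] order_tendstoD(2)[OF \<delta>, of 1] order_tendstoD(2)[OF E, of \<epsilon>] assms by auto
  show ?thesis
    using ev M
  proof eventually_elim
    case (elim l)
    show ?case
    proof (intro allI impI)
      fix v1 v2 \<alpha>1 \<alpha>2 :: real
      assume v: "\<bar>v1\<bar> \<le> B" "\<bar>v2\<bar> \<le> B"
      define gg where "gg = csqrt (local_density (L l) (M l) (b l) v1 * local_density (L l) (M l) (b l) v2)"
      define h where "h = exp (- (v1\<^sup>2 + v2\<^sup>2) / 4) / sqrt (2 * pi)"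
      define K where "K = scaled_kernel c (L l) (M l) (N l) (b l) v1 v2 \<alpha>1 \<alpha>2"
      have q0: "0 \<le> 2 * q l / (1 - q l)" using elim by (simp add: q_def)
      have 1: "cmod (K - gg / (2 * of_real pi)) \<le> cmod gg / (2 * pi) * (2 * q l / (1 - q l))"
        unfolding K_def scaled_kernel_def Let_def gg_def q_def s_def
        by (rule scaled_kernel_approx) (use L b v elim assms in \<open>auto simp: q_def s_def\<close>)
      have 2: "cmod (gg - of_real h) \<le> H l"
        unfolding gg_def h_def H_def
      proof (rule csqrt_local_density_approx[OF v])
        show "cmod (local_density (L l) (M l) (b l) v - of_real (exp (- (v\<^sup>2) / 2) / sqrt (2 * pi))) \<le> \<delta> l" for v
          unfolding \<delta>_def using L[of l] b(1)[of l] elim by (intro local_density_approx) auto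
        thus "cmod (local_density (L l) (M l) (b l) v2 - of_real (exp (- (v2\<^sup>2) / 2) / sqrt (2 * pi))) \<le> \<delta> l" .
      qed (use elim in auto)
      have "0 \<le> h" "h \<le> 1"
      proof -
        have "exp (- (v1\<^sup>2 + v2\<^sup>2) / 4) \<le> 1" by simp
        also have "1 \<le> sqrt (2 * pi)" using pi_ge_two by simp
        finally show "0 \<le> h" "h \<le> 1" by (auto simp: h_def)
      qed
      hence 3: "cmod gg \<le> 1 + H l"
        using norm_triangle_ineq[of "gg - of_real h" "of_real h"] 2 by simp
      have H0: "0 \<le> H l" using 2 norm_ge_zero order_trans by blast
      have pi: "x / (2 * pi) \<le> x" if "0 \<le> x" for x
        using that pi_ge_two mult_left_mono[of 1 "2 * pi" x] by (simp add: divide_le_eq)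
      have "cmod (K - of_real (h / (2 * pi))) \<le> cmod (K - gg / (2 * of_real pi)) + cmod (gg / (2 * of_real pi) - of_real (h / (2 * pi)))"
        by (rule norm_diff_triangle_ineq[of K "gg / (2 * of_real pi)" "gg / (2 * of_real pi)", simplified])
      also have "gg / (2 * of_real pi) - of_real (h / (2 * pi)) = (gg - of_real h) / (2 * of_real pi)"
        by (simp add: diff_divide_distrib)
      also have "cmod \<dots> \<le> H l"
        using 2 pi[of "cmod (gg - of_real h)"] by (simp add: norm_divide norm_mult)
      also have "cmod (K - gg / (2 * of_real pi)) \<le> (1 + H l) * (2 * q l / (1 - q l))"
        using 1 by (rule order_trans) (intro mult_right_mono q0 order_trans[OF pi 3], simp)
      finally have "cmod (K - of_real (h / (2 * pi))) \<le> E l" by (simp add: E_def)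
      also have "E l < \<epsilon>" using elim by simp
      finally show "cmod (scaled_kernel c (L l) (M l) (N l) (b l) v1 v2 \<alpha>1 \<alpha>2
          - of_real (exp (- (v1\<^sup>2 + v2\<^sup>2) / 4) / sqrt (2 * pi) / (2 * pi))) < \<epsilon>"
        by (simp only: K_def h_def)
    qed
  qed
qed

text \<open>In the Leibniz formula each permutation uses every row factor and every column factor
  exactly once.\<close>

lemma det_scale_rows_columns:
  fixes A :: "nat \<Rightarrow> nat \<Rightarrow> 'a :: comm_ring_1"
  shows "Determinant.det (Matrix.mat n n (\<lambda>(i, j). r i * c j * A i j))
    = (\<Prod>i<n. r i) * (\<Prod>i<n. c i) * Determinant.det (Matrix.mat n n (\<lambda>(i, j). A i j))"
proof -
  have "signof p * (\<Prod>i = 0..<n. r i * c (p i) * A i (p i))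
      = (\<Prod>i<n. r i) * (\<Prod>i<n. c i) * (signof p * (\<Prod>i = 0..<n. A i (p i)))"
    if p: "p permutes {0..<n}" for p
  proof -
    have "(\<Prod>i = 0..<n. c (p i)) = (\<Prod>i = 0..<n. c i)"
      using prod.permute[OF p, of c] by (simp add: o_def)
    thus ?thesis by (simp add: prod.distrib atLeast0LessThan mult_ac)
  qed
  moreover have "p i < n" if "p permutes {0..<n}" "i < n" for p i
    using permutes_in_image[OF that(1), of i] that(2) by simp
  ultimately show ?thesis
    by (subst (1 2) det_def'[of _ n]) (auto simp: sum_distrib_left intro!: sum.cong)
qed

text \<open>Taking out the factors leaves the all-ones matrix, whose first two rows coincide when
  \<open>n > 1\<close>.\<close>

lemma det_rank_one:
  fixes r :: "nat \<Rightarrow> 'a :: comm_ring_1"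
  assumes "n \<ge> 1"
  shows "Determinant.det (Matrix.mat n n (\<lambda>(i, j). r i * c j)) = (if n = 1 then r 0 * c 0 else 0)"
proof (cases "n = 1")
  case True
  thus ?thesis by (subst det_def'[of _ n]) (auto simp: permutes_sing)
next
  case False
  let ?J = "Matrix.mat n n (\<lambda>(i, j). 1 :: 'a)"
  have "Determinant.det ?J = 0"
    by (rule det_identical_rows[of _ n 0 1]) (use assms False in auto)
  thus ?thesis using det_scale_rows_columns[of n r c "\<lambda>_ _. 1"] False by simp
qed

section \<open>Uniform limits of sums, products and determinants\<close>

lemma uniform_limit_sum:
  fixes f :: "'i \<Rightarrow> 'l \<Rightarrow> 'x \<Rightarrow> 'a :: real_normed_vector"
  assumes "\<And>i. i \<in> I \<Longrightarrow> uniform_limit S (f i) (g i) F"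
  shows "uniform_limit S (\<lambda>l x. \<Sum>i\<in>I. f i l x) (\<lambda>x. \<Sum>i\<in>I. g i x) F"
  using assms by (induction I rule: infinite_finite_induct) (auto intro!: uniform_limit_intros)

text \<open>Multiplying uniform limits requires bounded limit functions, so boundedness of the
  product is carried through the induction.\<close>

lemma uniform_limit_prod:
  fixes f :: "'i \<Rightarrow> 'l \<Rightarrow> 'x \<Rightarrow> 'a :: {real_normed_algebra, comm_ring_1}"
  assumes "finite I" "\<And>i. i \<in> I \<Longrightarrow> uniform_limit S (f i) (g i) F" "\<And>i. i \<in> I \<Longrightarrow> bounded (g i ` S)"
  shows "uniform_limit S (\<lambda>l x. \<Prod>i\<in>I. f i l x) (\<lambda>x. \<Prod>i\<in>I. g i x) F
    \<and> bounded ((\<lambda>x. \<Prod>i\<in>I. g i x) ` S)"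
  using assms
proof (induction I rule: finite_induct)
  case empty
  show ?case by (auto intro: uniform_limit_const finite_imp_bounded finite_subset[of _ "{1}"])
next
  case (insert i I)
  have "bounded ((\<lambda>x. g i x * (\<Prod>i\<in>I. g i x)) ` S)"
  proof -
    obtain C D where "\<And>x. x \<in> S \<Longrightarrow> norm (g i x) \<le> C" "\<And>x. x \<in> S \<Longrightarrow> norm (\<Prod>i\<in>I. g i x) \<le> D"
      using insert by (force simp: bounded_iff)
    hence "norm (g i x * (\<Prod>i\<in>I. g i x)) \<le> \<bar>C\<bar> * \<bar>D\<bar>" if "x \<in> S" for x
      using that by (intro order_trans[OF norm_mult_ineq] mult_mono) (auto intro: order_trans[OF _ abs_ge_self])
    thus ?thesis by (auto simp: bounded_iff)
  qed
  thus ?case using insert by (auto intro!: uniform_lim_mult)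
qed

lemma uniform_limit_det:
  fixes A :: "'l \<Rightarrow> 'x \<Rightarrow> nat \<Rightarrow> nat \<Rightarrow> complex"
  assumes "\<And>i j. i < n \<Longrightarrow> j < n \<Longrightarrow> uniform_limit S (\<lambda>l x. A l x i j) (\<lambda>x. G x i j) F"
    and "\<And>i j. i < n \<Longrightarrow> j < n \<Longrightarrow> bounded ((\<lambda>x. G x i j) ` S)"
  shows "uniform_limit S (\<lambda>l x. Determinant.det (Matrix.mat n n (\<lambda>(i, j). A l x i j)))
    (\<lambda>x. Determinant.det (Matrix.mat n n (\<lambda>(i, j). G x i j))) F"
proof -
  have lt: "p i < n" if "p permutes {0..<n}" "i < n" for p i
    using permutes_in_image[OF that(1), of i] that(2) by simp
  have det: "Determinant.det (Matrix.mat n n (\<lambda>(i, j). X i j))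
      = (\<Sum>p | p permutes {0..<n}. signof p * (\<Prod>i = 0..<n. X i (p i)))" for X :: "nat \<Rightarrow> nat \<Rightarrow> complex"
    by (subst det_def'[of _ n]) (auto intro!: sum.cong prod.cong simp: lt)
  have "uniform_limit S (\<lambda>l x. \<Sum>p | p permutes {0..<n}. signof p * (\<Prod>i = 0..<n. A l x i (p i)))
     (\<lambda>x. \<Sum>p | p permutes {0..<n}. signof p * (\<Prod>i = 0..<n. G x i (p i))) F"
  proof (rule uniform_limit_sum)
    fix p assume "p \<in> {p. p permutes {0..<n}}"
    hence p: "p permutes {0..<n}" by simp
    have "uniform_limit S (\<lambda>l x. \<Prod>i = 0..<n. A l x i (p i)) (\<lambda>x. \<Prod>i = 0..<n. G x i (p i)) F"
      using lt[OF p] assms by (intro uniform_limit_prod[THEN conjunct1]) auto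
    thus "uniform_limit S (\<lambda>l x. signof p * (\<Prod>i = 0..<n. A l x i (p i)))
        (\<lambda>x. signof p * (\<Prod>i = 0..<n. G x i (p i))) F"
      by (rule bounded_linear.uniform_limit[OF bounded_linear_mult_right])
  qed
  thus ?thesis by (simp only: det)
qed

section \<open>The correlation functions\<close>

lemma Digamma_diff:
  fixes b :: nat
  assumes "1 \<le> b"
  shows "Digamma (real b) - Digamma (real b + real L) = - (\<Sum>m<L. 1 / (real b + real m))"
proof -
  have "\<forall>k<L. real b \<noteq> - real k" using assms by linarith
  from Polygamma_plus_of_nat[OF this, of 0] show ?thesis by simp
qed

lemma deriv_Digamma_diff:
  fixes b :: nat
  assumes "1 \<le> b"
  shows "deriv Digamma (real b) - deriv Digamma (real b + real L) = (\<Sum>m<L. 1 / (real b + real m)\<^sup>2)"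
proof -
  have "\<forall>k<L. real b \<noteq> - real k" using assms by linarith
  from Polygamma_plus_of_nat[OF this, of 1]
  have "Polygamma 1 (real b + real L) = Polygamma 1 (real b) - (\<Sum>m<L. 1 / (real b + real m)\<^sup>2)"
    by (simp add: numeral_2_eq_2)
  moreover have "x \<notin> \<int>\<^sub>\<le>\<^sub>0" if "0 < x" for x :: real
    using that by (auto elim!: nonpos_Ints_cases)
  hence "deriv Digamma x = Polygamma 1 x" if "0 < x" for x :: real
    using that deriv_Polygamma[of x 0] by simp
  ultimately show ?thesis using assms by simp
qed

lemma rho_eq:
  assumes "k \<in> {1..N}"
  shows "rho L N k = 2 / sqrt (real N * (\<Sum>m<L. 1 / (real (N - k + 1) + real m)\<^sup>2))"
proof -
  have "real N - real k + 1 = real (N - k + 1)" "real L + real N - real k + 1 = real (N - k + 1) + real L"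
    using assms by (auto simp: of_nat_diff)
  thus ?thesis unfolding rho_def by (simp only: deriv_Digamma_diff[of "N - k + 1" L])
qed

lemma scaling_factor_eq:
  assumes "k \<in> {1..N}"
  shows "sqrt (real M) / (rho L N k * sqrt (real N)) = spread L M (N - k + 1) / 2"
proof -
  have "sqrt (real N) > 0" using assms by auto
  thus ?thesis unfolding rho_eq[OF assms] spread_def by (simp add: real_sqrt_mult)
qed

lemma scaled_point_eq:
  assumes "k \<in> {1..N}" "M \<ge> 1"
  shows "scaled_point L M N k \<theta> v \<phi> = of_real (exp ((v * spread L M (N - k + 1)
      - real M * (\<Sum>m<L. 1 / (real (N - k + 1) + real m))) / 2)) * cis (\<theta> + \<phi>)"
proof -
  define b where "b = N - k + 1"
  have r: "real N - real k + 1 = real b" "real L + real N - real k + 1 = real b + real L"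
    using assms by (auto simp: of_nat_diff b_def)
  have N: "sqrt (real N) > 0" using assms by auto
  define m where "m = sqrt (real M)"
  have m: "m > 0" "real M = m * m" "sqrt (real M * real N) = m * sqrt (real N)"
    using assms by (auto simp: m_def real_sqrt_mult)
  have "v / (rho L N k * sqrt (real M * real N)) = v / real M * (m / (rho L N k * sqrt (real N)))"
    unfolding m(3) unfolding m(2) using m(1) by simp
  hence e: "v / (rho L N k * sqrt (real M * real N)) = v / real M * (spread L M b / 2)"
    unfolding m_def scaling_factor_eq[OF assms(1)] by (simp add: b_def)
  have "real M * (1 / 2 * (Digamma (real b) - Digamma (real b + real L)) + v / real M * (spread L M b / 2))
      = (v * spread L M b - real M * (\<Sum>m<L. 1 / (real b + real m))) / 2"
    unfolding Digamma_diff[of b L, unfolded b_def, simplified, folded b_def] using assms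
    by (subst Digamma_diff) (auto simp: b_def field_simps)
  thus ?thesis unfolding scaled_point_def r e cis_conv_exp by (simp add: b_def)
qed

text \<open>Row \<open>i\<close> absorbs \<open>s / 2\<close>, one factor
  \<open>cmod (z (Suc i))\<close> and a phase; column \<open>i\<close> absorbs the other factor of
  the square and the opposite phase. Matrix indices start at 0 and points at 1, hence
  \<open>Suc\<close>.\<close>

lemma scaled_kernel_det_eq:
  fixes L M N k n :: nat and \<theta> c :: real and v \<phi> :: "nat \<Rightarrow> real"
  assumes k: "k \<in> {1..N}" and "M \<ge> 1"
  defines "z \<equiv> \<lambda>j. scaled_point L M N k \<theta> (v j) (\<phi> j)"
  shows "of_real ((sqrt (real M) / (rho L N k * sqrt (real N))) ^ n * (cmod (\<Prod>j=1..n. z j))\<^sup>2)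
      * kernel_det (truncated_kernel c L M N) n z
    = Determinant.det (Matrix.mat n n (\<lambda>(i, j). scaled_kernel c L M N (N - k + 1)
        (v (Suc i)) (v (Suc j)) (\<theta> + \<phi> (Suc i)) (\<theta> + \<phi> (Suc j))))"
proof -
  define b where "b = N - k + 1"
  define s where "s = spread L M b"
  define r where "r = (\<lambda>i. of_real (s / 2) * (of_real (cmod (z (Suc i))) * cis (- ((real b - 1) * (\<theta> + \<phi> (Suc i))))))"
  define q where "q = (\<lambda>j. of_real (cmod (z (Suc j))) * cis ((real b - 1) * (\<theta> + \<phi> (Suc j))))"
  have "scaled_kernel c L M N b (v (Suc i)) (v (Suc j)) (\<theta> + \<phi> (Suc i)) (\<theta> + \<phi> (Suc j))
      = r i * q j * truncated_kernel c L M N (z (Suc i)) (z (Suc j))" for i j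
    unfolding scaled_kernel_def Let_def r_def q_def s_def z_def scaled_point_eq[OF assms(1,2)] b_def
    by (simp only: mult.assoc)
  hence "Determinant.det (Matrix.mat n n (\<lambda>(i, j). scaled_kernel c L M N b
        (v (Suc i)) (v (Suc j)) (\<theta> + \<phi> (Suc i)) (\<theta> + \<phi> (Suc j))))
     = (\<Prod>i<n. r i) * (\<Prod>i<n. q i) * kernel_det (truncated_kernel c L M N) n z"
    unfolding kernel_det_def by (simp only: det_scale_rows_columns)
  also have "(\<Prod>i<n. r i) * (\<Prod>i<n. q i) = (\<Prod>i<n. of_real (s / 2 * (cmod (z (Suc i)))\<^sup>2))"
  proof -
    have "r i * q i = of_real (s / 2 * (cmod (z (Suc i)))\<^sup>2) *
        (cis (- ((real b - 1) * (\<theta> + \<phi> (Suc i)))) * cis ((real b - 1) * (\<theta> + \<phi> (Suc i))))" for i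
      by (simp add: r_def q_def power2_eq_square)
    hence "r i * q i = of_real (s / 2 * (cmod (z (Suc i)))\<^sup>2)" for i
      by (simp add: cis_mult)
    thus ?thesis by (simp only: prod.distrib[symmetric])
  qed
  also have "\<dots> = of_real (\<Prod>i<n. s / 2 * (cmod (z (Suc i)))\<^sup>2)" by simp
  also have "(\<Prod>i<n. s / 2 * (cmod (z (Suc i)))\<^sup>2) = (s / 2) ^ n * (cmod (\<Prod>j=1..n. z j))\<^sup>2"
  proof -
    have "(\<Prod>j=1..n. z j) = (\<Prod>i<n. z (Suc i))"
      by (rule prod.reindex_bij_witness[of _ Suc "\<lambda>j. j - 1"]) auto
    thus ?thesis by (simp only: prod.distrib prod_constant card_lessThan prod_power_distrib prod_norm[symmetric])
  qed
  finally show ?thesis unfolding scaling_factor_eq[OF k] by (simp only: b_def s_def)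
qed

text \<open>Replacing every \<open>b + m\<close> by the larger \<open>N + L\<close> gives a lower
  bound free of \<open>b\<close>, hence of \<open>k\<close>. With \<open>lam = L / N\<close> it
  equals \<open>lam / (1 + lam)\<^sup>2 * (M / N)\<close>, a factor with positive limit times one
  that diverges.\<close>

lemma spread_at_top:
  fixes L M N b :: "nat \<Rightarrow> nat"
  assumes "\<And>l. N l \<ge> 1" and b: "\<And>l. 1 \<le> b l" "\<And>l. b l \<le> N l" and "\<tau> > 0"
    and MN: "filterlim (\<lambda>l. real (M l) / real (N l)) at_top sequentially"
    and LN: "(\<lambda>l. real (L l) / real (N l)) \<longlonglongrightarrow> \<tau>"
  shows "filterlim (\<lambda>l. spread (L l) (M l) (b l)) at_top sequentially"
proof -
  define lam where "lam = (\<lambda>l. real (L l) / real (N l))"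
  have lim: "(\<lambda>l. lam l / (1 + lam l)\<^sup>2) \<longlonglongrightarrow> \<tau> / (1 + \<tau>)\<^sup>2"
    using LN \<open>\<tau> > 0\<close> unfolding lam_def by (intro tendsto_intros) auto
  have "filterlim (\<lambda>l. lam l / (1 + lam l)\<^sup>2 * (real (M l) / real (N l))) at_top sequentially"
    using \<open>\<tau> > 0\<close> by (intro filterlim_tendsto_pos_mult_at_top[OF lim _ MN]) auto
  moreover have "lam l / (1 + lam l)\<^sup>2 * (real (M l) / real (N l)) \<le> (spread (L l) (M l) (b l))\<^sup>2" for l
  proof -
    have N: "real (N l) > 0" using assms(1)[of l] by simp
    have "1 + lam l = (real (N l) + real (L l)) / real (N l)" using N by (simp add: lam_def field_simps)
    hence "lam l / (1 + lam l)\<^sup>2 * (real (M l) / real (N l)) = real (M l) * (\<Sum>m<L l. 1 / (real (N l) + real (L l))\<^sup>2)"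
      using N by (simp add: lam_def power_divide) (simp add: power2_eq_square)
    also have "\<dots> \<le> real (M l) * (\<Sum>m<L l. 1 / (real (b l) + real m)\<^sup>2)"
    proof (intro mult_left_mono sum_mono divide_left_mono power_mono)
      fix m assume "m \<in> {..<L l}"
      thus "real (b l) + real m \<le> real (N l) + real (L l)" using b(2)[of l] by simp
      have "0 < real (b l) + real m" "0 < real (N l) + real (L l)" using b(1)[of l] N by auto
      thus "0 < (real (N l) + real (L l))\<^sup>2 * (real (b l) + real m)\<^sup>2" by simp
    qed auto
    finally show ?thesis by (simp add: spread_power2)
  qed
  ultimately have "filterlim (\<lambda>l. (spread (L l) (M l) (b l))\<^sup>2) at_top sequentially"
    by (rule filterlim_at_top_mono[OF _ always_eventually[OF allI]])
  hence "filterlim (\<lambda>l. sqrt ((spread (L l) (M l) (b l))\<^sup>2)) at_top sequentially"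
    by (rule filterlim_compose[OF sqrt_at_top])
  thus ?thesis by (simp add: spread_def sum_nonneg)
qed

theorem theorem3p1:
  fixes L M N k :: "nat \<Rightarrow> nat"
    and P :: "nat \<Rightarrow> 'w measure"
    and X :: "nat \<Rightarrow> nat \<Rightarrow> 'w \<Rightarrow> complex mat"
    and R :: "nat \<Rightarrow> (nat \<Rightarrow> complex) \<Rightarrow> real"
    and n :: nat and \<tau> \<theta> c :: real and V :: "real set"
  assumes "n \<ge> 1" and "c > 0"
    and "\<And>l. L l \<ge> 1" and "\<And>l. M l \<ge> 1" and "\<And>l. N l \<ge> 1"
    and "\<And>l. k l \<in> {1..N l}"
    and "filterlim (\<lambda>l. M l + N l) at_top sequentially"
    and "filterlim (\<lambda>l. real (M l) / real (N l)) at_top sequentially"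
    and "\<tau> > 0" and "(\<lambda>l. real (L l) / real (N l)) \<longlonglongrightarrow> \<tau>"
    and model: "\<And>l. iid_truncated_unitary (P l) (N l) (L l) (M l) (X l)"
    and corr: "\<And>l. correlation_function (P l)
      (\<lambda>\<omega>. eigenvalue_list (mat_product (N l) (\<lambda>i. X l i \<omega>) (M l))) n (R l)"
    and determinantal: "\<And>l z. complex_of_real (R l z) = kernel_det (truncated_kernel c (L l) (M l) (N l)) n z"
    and "\<theta> \<in> {-pi<..pi}"
    and "compact V"
  shows "uniform_limit (({1..n} \<rightarrow> V) \<times> ({1..n} \<rightarrow> {-pi<..pi}))
    (\<lambda>l (v, \<phi>).
       let z = (\<lambda>j. scaled_point (L l) (M l) (N l) (k l) \<theta> (v j) (\<phi> j))
       in (sqrt (real (M l)) / (rho (L l) (N l) (k l) * sqrt (real (N l)))) ^ n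
          * (cmod (\<Prod>j=1..n. z j))\<^sup>2 * R l z)
    (\<lambda>(v, \<phi>). if n = 1 then 1 / sqrt (2 * pi) ^ 3 * exp (- (1 / 2) * (v 1)\<^sup>2) else 0)
    sequentially"
proof -
  let ?S = "({1..n} \<rightarrow> V) \<times> ({1..n} \<rightarrow> {-pi<..pi})"
  define b where "b = (\<lambda>l. N l - k l + 1)"
  have b: "1 \<le> b l" "b l \<le> N l" for l using assms(6)[of l] by (auto simp: b_def)
  obtain B where B: "\<And>v. v \<in> V \<Longrightarrow> \<bar>v\<bar> \<le> B"
    using compact_imp_bounded[OF \<open>compact V\<close>] by (auto simp: bounded_iff)
  define A where "A = (\<lambda>l (x :: (nat \<Rightarrow> real) \<times> (nat \<Rightarrow> real)) i j. scaled_kernel c (L l) (M l) (N l) (b l)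
      (fst x (Suc i)) (fst x (Suc j)) (\<theta> + snd x (Suc i)) (\<theta> + snd x (Suc j)))"
  \<comment> \<open>The limit \<open>exp (- (v1\<^sup>2 + v2\<^sup>2) / 4)\<close> splits into a
    function of each variable, so the limit matrix \<open>G\<close> has rank one.\<close>
  define e where "e = (\<lambda>(x :: (nat \<Rightarrow> real) \<times> (nat \<Rightarrow> real)) i. exp (- ((fst x (Suc i))\<^sup>2) / 4))"
  define r where "r = (\<lambda>x i. complex_of_real (e x i / sqrt (2 * pi) / (2 * pi)))"
  define G where "G = (\<lambda>x i j. r x i * complex_of_real (e x j))"
  have spread: "filterlim (\<lambda>l. spread (L l) (M l) (b l)) at_top sequentially"
    using assms(5) b assms(9,8,10) by (rule spread_at_top)
  \<comment> \<open>Since \<open>N \<ge> 1\<close>, a ratio \<open>M / N\<close> of at least 2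
    forces \<open>M \<ge> 2\<close>.\<close>
  have M2: "eventually (\<lambda>l. M l \<ge> 2) sequentially"
  proof -
    have "eventually (\<lambda>l. 2 \<le> real (M l) / real (N l)) sequentially"
      using assms(8) by (simp add: filterlim_at_top)
    thus ?thesis
    proof eventually_elim
      case (elim l)
      have "2 * 1 \<le> 2 * real (N l)" using assms(5)[of l] by simp
      also have "\<dots> \<le> real (M l)" using elim assms(5)[of l] by (simp add: field_simps)
      finally show ?case by simp
    qed
  qed
  have unif: "uniform_limit ?S (\<lambda>l x. A l x i j) (\<lambda>x. G x i j) sequentially" if ij: "i < n" "j < n" for i j
  proof (rule uniform_limitI)
    fix \<epsilon> :: real assume \<epsilon>: "\<epsilon> > 0"
    show "eventually (\<lambda>l. \<forall>x\<in>?S. dist (A l x i j) (G x i j) < \<epsilon>) sequentially"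
      using scaled_kernel_limit[OF assms(3) M2 b \<open>c > 0\<close> \<epsilon> spread, of B]
    proof eventually_elim
      case (elim l)
      show ?case
      proof
        fix x assume x: "x \<in> ?S"
        have "\<bar>fst x (Suc i)\<bar> \<le> B" "\<bar>fst x (Suc j)\<bar> \<le> B" using x ij by (auto intro!: B)
        moreover have "G x i j = of_real (exp (- ((fst x (Suc i))\<^sup>2 + (fst x (Suc j))\<^sup>2) / 4) / sqrt (2 * pi) / (2 * pi))"
        proof -
          have "exp (- ((fst x (Suc i))\<^sup>2 + (fst x (Suc j))\<^sup>2) / 4) = e x i * e x j"
            by (simp add: e_def exp_add[symmetric] diff_divide_distrib)
          thus ?thesis by (simp add: G_def r_def)
        qed
        ultimately show "dist (A l x i j) (G x i j) < \<epsilon>"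
          using elim by (simp add: A_def dist_norm)
      qed
    qed
  qed
  have bdd: "bounded ((\<lambda>x. G x i j) ` ?S)" for i j
  proof -
    have "cmod (G x i j) \<le> 1 / sqrt (2 * pi) / (2 * pi) * 1" for x
      unfolding G_def r_def norm_mult norm_of_real
      by (intro mult_mono) (auto simp: e_def divide_right_mono)
    thus ?thesis unfolding bounded_iff by blast
  qed
  have lim: "uniform_limit ?S (\<lambda>l x. Determinant.det (Matrix.mat n n (\<lambda>(i, j). A l x i j)))
      (\<lambda>x. Determinant.det (Matrix.mat n n (\<lambda>(i, j). G x i j))) sequentially"
    by (intro uniform_limit_det unif bdd)
  show ?thesis
  proof (rule uniform_limitI)
    fix \<epsilon> :: real assume "\<epsilon> > 0"
    show "eventually (\<lambda>l. \<forall>x\<in>?S. dist (case x of (v, \<phi>) \<Rightarrow>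
       let z = (\<lambda>j. scaled_point (L l) (M l) (N l) (k l) \<theta> (v j) (\<phi> j))
       in (sqrt (real (M l)) / (rho (L l) (N l) (k l) * sqrt (real (N l)))) ^ n
          * (cmod (\<Prod>j=1..n. z j))\<^sup>2 * R l z)
       (case x of (v, \<phi>) \<Rightarrow> if n = 1 then 1 / sqrt (2 * pi) ^ 3 * exp (- (1 / 2) * (v 1)\<^sup>2) else 0) < \<epsilon>) sequentially"
      using uniform_limitD[OF lim \<open>\<epsilon> > 0\<close>]
    proof eventually_elim
      case (elim l)
      show ?case
      proof clarify
        fix v \<phi> :: "nat \<Rightarrow> real"
        assume v: "v \<in> {1..n} \<rightarrow> V" "\<phi> \<in> {1..n} \<rightarrow> {-pi<..pi}"
        define z where "z = (\<lambda>j. scaled_point (L l) (M l) (N l) (k l) \<theta> (v j) (\<phi> j))"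
        \<comment> \<open>\<open>R\<close> is real while the kernel determinant is complex; the
          comparison is made in the complex numbers and returned by the isometry
          \<open>complex_of_real\<close>.\<close>
        have "complex_of_real (a * R l z) = complex_of_real a * kernel_det (truncated_kernel c (L l) (M l) (N l)) n z" for a
          by (simp add: determinantal)
        hence "complex_of_real ((sqrt (real (M l)) / (rho (L l) (N l) (k l) * sqrt (real (N l)))) ^ n
          * (cmod (\<Prod>j=1..n. z j))\<^sup>2 * R l z) = Determinant.det (Matrix.mat n n (\<lambda>(i, j). A l (v, \<phi>) i j))"
          unfolding A_def b_def fst_conv snd_conv z_def
          using scaled_kernel_det_eq[OF assms(6,4), where L = "L l" and n = n and \<theta> = \<theta> and c = c and v = v and \<phi> = \<phi>] by (simp only:)
        moreover have "complex_of_real (if n = 1 then 1 / sqrt (2 * pi) ^ 3 * exp (- (1 / 2) * (v 1)\<^sup>2) else 0)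
          = Determinant.det (Matrix.mat n n (\<lambda>(i, j). G (v, \<phi>) i j))"
        proof -
          have "e (v, \<phi>) 0 / sqrt (2 * pi) / (2 * pi) * e (v, \<phi>) 0 = 1 / sqrt (2 * pi) ^ 3 * exp (- (1 / 2) * (v 1)\<^sup>2)"
          proof -
            have "e (v, \<phi>) 0 * e (v, \<phi>) 0 = exp (- (1 / 2) * (v 1)\<^sup>2)"
              by (simp add: e_def exp_add[symmetric])
            \<comment> \<open>One \<open>sqrt (2 * pi)\<close> normalizes the Gaussian density; the
              factor \<open>2 * pi\<close> is the constant of the rescaled kernel.\<close>
            moreover have "sqrt (2 * pi) ^ 3 = sqrt (2 * pi) * (2 * pi)"
              by (simp add: power3_eq_cube)
            ultimately show ?thesis by simp
          qed
          hence "complex_of_real (1 / sqrt (2 * pi) ^ 3 * exp (- (1 / 2) * (v 1)\<^sup>2)) = r (v, \<phi>) 0 * of_real (e (v, \<phi>) 0)"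
            unfolding r_def of_real_mult[symmetric] by (simp only:)
          thus ?thesis unfolding G_def det_rank_one[OF \<open>n \<ge> 1\<close>] by simp
        qed
        ultimately have "dist ((sqrt (real (M l)) / (rho (L l) (N l) (k l) * sqrt (real (N l)))) ^ n
            * (cmod (\<Prod>j=1..n. z j))\<^sup>2 * R l z)
            (if n = 1 then 1 / sqrt (2 * pi) ^ 3 * exp (- (1 / 2) * (v 1)\<^sup>2) else 0)
          = dist (Determinant.det (Matrix.mat n n (\<lambda>(i, j). A l (v, \<phi>) i j)))
              (Determinant.det (Matrix.mat n n (\<lambda>(i, j). G (v, \<phi>) i j)))"
          by (metis dist_of_real)
        also have "\<dots> < \<epsilon>" using elim v by blast
        finally show "dist (let z = (\<lambda>j. scaled_point (L l) (M l) (N l) (k l) \<theta> (v j) (\<phi> j))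
             in (sqrt (real (M l)) / (rho (L l) (N l) (k l) * sqrt (real (N l)))) ^ n
                * (cmod (\<Prod>j=1..n. z j))\<^sup>2 * R l z)
             (if n = 1 then 1 / sqrt (2 * pi) ^ 3 * exp (- (1 / 2) * (v 1)\<^sup>2) else 0) < \<epsilon>"
          by (simp only: Let_def z_def)
      qed
    qed
  qed
qed

end
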